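(* Let $S$ be a numerical semigroup minimally generated by four elements, and let $A$ be the graded Artinian algebra over $\Bbbk$ associated to the Apéry set of $S$ (so $A$ has codimension three). If $A$ is Gorenstein, then $A$ has the SLP.
   Context: $\Bbbk$ is a field of characteristic zero. A numerical semigroup $S$ is a submonoid of $(\mathbb{N},+)$ with finite complement; let $g_1<g_2<\cdots<g_r$ be its minimal generators. The Apéry set of $S$ (with respect to the multiplicity $g_1$) is $\operatorname{Ap}(S)=\{s\in S: s-g_1\notin S\}$. The order of $s\in S$ is $\operatorname{ord}(s)=\max\{\lambda_1+\cdots+\lambda_r : s=\lambda_1g_1+\cdots+\lambda_rg_r,\ \lambda_i\in\mathbb{N}\}$. The graded algebra associated to the Apéry set of $S$ is the associated graded ring, with respect to the maximal ideal, of $\Bbbk[[S]]/(t^{g_1})$, where $\Bbbk[[S]]=\Bbbk[[t^{g_1},\ldots,t^{g_r}]]$. Concretely, it is the $\Bbbk$-vector space $A=\bigoplus_{\omega\in\operatorname{Ap}(S)}\Bbbk\, t^{\omega}$, with $t^\omega$ in degree $\operatorname{ord}(\omega)$, and with multiplication $t^{\omega}\cdot t^{\omega'}=t^{\omega+\omega'}$ if $\omega+\omega'\in\operatorname{Ap}(S)$ and $\operatorname{ord}(\omega+\omega')=\operatorname{ord}(\omega)+\operatorname{ord}(\omega')$, and $t^{\omega}\cdot t^{\omega'}=0$ otherwise. It is a standard graded Artinian algebra of codimension $\dim_\Bbbk A_1=r-1$. A standard graded Artinian algebra $A$ has the strong Lefschetz property (SLP) if there is a linear form $\ell\in A_1$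 such that for all $j\ge1$ and all $i$ the multiplication map $\cdot\ell^j:A_i\to A_{i+j}$ has maximal rank (i.e. is injective or surjective). *)

theory Defs
  imports Complex_Main "HOL-Computational_Algebra.Polynomial"
begin

section \<open>Numerical semigroups\<close>

definition numerical_semigroup :: "nat set \<Rightarrow> bool" where
  "numerical_semigroup S \<longleftrightarrow>
     0 \<in> S \<and> (\<forall>a\<in>S. \<forall>b\<in>S. a + b \<in> S) \<and> finite (- S)"

definition generated_submonoid :: "nat set \<Rightarrow> nat set" where
  "generated_submonoid G = {(\<Sum>g\<in>G. c g * g) |c :: nat \<Rightarrow> nat. True}"

definition minimally_generates :: "nat set \<Rightarrow> nat set \<Rightarrow> bool" where
  "minimally_generates G S \<longleftrightarrow>
     finite G \<and> generated_submonoid G = S \<and> (\<forall>H. H \<subset> G \<longrightarrow> generated_submonoid H \<noteq> S)"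

text \<open>The membership test is done over the integers, so that the difference is not truncated.\<close>

definition apery_set :: "nat set \<Rightarrow> nat \<Rightarrow> nat set" where
  "apery_set S m = {s \<in> S. int s - int m \<notin> int ` S}"

definition sg_ord :: "nat set \<Rightarrow> nat \<Rightarrow> nat" where
  "sg_ord G s = Max {(\<Sum>g\<in>G. c g) |c :: nat \<Rightarrow> nat. s = (\<Sum>g\<in>G. c g * g)}"


section \<open>Standard graded Artinian algebras\<close>

text \<open>
  The algebra is the internal direct sum of the homogeneous components \<open>A i\<close>, all living in one
  ambient vector space. The product is only constrained on the elements of the algebra.
\<close>

locale standard_graded_artinian_algebra = vector_space scale
  for scale :: "'k::field \<Rightarrow> 'a::ab_group_add \<Rightarrow> 'a" (infixr \<open>*s\<close> 75) +
  fixes prod :: "'a \<Rightarrow> 'a \<Rightarrow> 'a" (infixl \<open>\<star>\<close> 70)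
    and one :: 'a
    and A :: "nat \<Rightarrow> 'a set"
  assumes subspace_component: "subspace (A i)"
    and direct: "(\<And>i. i \<le> n \<Longrightarrow> f i \<in> A i) \<Longrightarrow> (\<Sum>i\<le>n. f i) = 0 \<Longrightarrow> i \<le> n \<Longrightarrow> f i = 0"
    and finite_dim: "\<exists>B. finite B \<and> A i \<subseteq> span B"
    and artinian: "\<exists>n. \<forall>i\<ge>n. A i = {0}"
    and prod_component: "x \<in> A i \<Longrightarrow> y \<in> A j \<Longrightarrow> x \<star> y \<in> A (i + j)"
    and prod_add_left: "\<lbrakk>x \<in> span (\<Union>i. A i); y \<in> span (\<Union>i. A i); z \<in> span (\<Union>i. A i)\<rbrakk>
          \<Longrightarrow> (x + y) \<star> z = x \<star> z + y \<star> z"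
    and prod_scale_left: "\<lbrakk>x \<in> span (\<Union>i. A i); y \<in> span (\<Union>i. A i)\<rbrakk>
          \<Longrightarrow> (c *s x) \<star> y = c *s (x \<star> y)"
    and prod_assoc: "\<lbrakk>x \<in> span (\<Union>i. A i); y \<in> span (\<Union>i. A i); z \<in> span (\<Union>i. A i)\<rbrakk>
          \<Longrightarrow> (x \<star> y) \<star> z = x \<star> (y \<star> z)"
    and prod_commute: "\<lbrakk>x \<in> span (\<Union>i. A i); y \<in> span (\<Union>i. A i)\<rbrakk> \<Longrightarrow> x \<star> y = y \<star> x"
    and one_prod: "x \<in> span (\<Union>i. A i) \<Longrightarrow> one \<star> x = x"
    and one_nonzero: "one \<noteq> 0"
    and connected: "A 0 = span {one}"
    and standard: "A (Suc i) = span {x \<star> y |x y. x \<in> A 1 \<and> y \<in> A i}"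
begin

definition algebra_carrier :: "'a set" where
  "algebra_carrier = span (\<Union>i. A i)"

definition irrelevant_ideal :: "'a set" where
  "irrelevant_ideal = span (\<Union>i\<in>{1..}. A i)"

definition socle :: "'a set" where
  "socle = {a \<in> algebra_carrier. \<forall>x\<in>irrelevant_ideal. x \<star> a = 0}"

text \<open>For Artinian algebras, being Gorenstein means having type one, i.e. a one-dimensional socle.\<close>

definition gorenstein :: bool where
  "gorenstein \<longleftrightarrow> dim socle = 1"

primrec algebra_power :: "'a \<Rightarrow> nat \<Rightarrow> 'a" where
  "algebra_power x 0 = one"
| "algebra_power x (Suc j) = x \<star> algebra_power x j"

definition strong_lefschetz :: bool where
  "strong_lefschetz \<longleftrightarrow>
     (\<exists>l\<in>A 1. \<forall>j\<ge>1. \<forall>i.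
        inj_on (\<lambda>x. algebra_power l j \<star> x) (A i) \<or>
        (\<lambda>x. algebra_power l j \<star> x) ` A i = A (i + j))"

end


section \<open>The graded algebra associated to the Apery set\<close>

text \<open>
  The basis vector \<open>t\<^sup>\<omega>\<close> is represented by the monomial of exponent \<open>\<omega>\<close>. Only the vector space
  structure of the polynomials is used; the product is \<open>apery_prod\<close>, and the unit is \<open>1\<close>.
\<close>

definition apery_component :: "nat set \<Rightarrow> nat set \<Rightarrow> nat \<Rightarrow> 'k::field poly set" where
  "apery_component S G i =
     module.span smult {monom 1 w |w. w \<in> apery_set S (Min G) \<and> sg_ord G w = i}"

definition apery_prod :: "nat set \<Rightarrow> nat set \<Rightarrow> 'k::field poly \<Rightarrow> 'k poly \<Rightarrow> 'k poly" where
  "apery_prod S G p q =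
     (\<Sum>u\<in>apery_set S (Min G). \<Sum>v\<in>apery_set S (Min G).
        if u + v \<in> apery_set S (Min G) \<and> sg_ord G (u + v) = sg_ord G u + sg_ord G v
        then monom (coeff p u * coeff q v) (u + v) else 0)"

text \<open>
  The rest of this theory shows that these data form a standard graded Artinian algebra, of
  codimension one less than the number of minimal generators.
\<close>

lemma vector_space_smult: "vector_space (smult :: 'k::field \<Rightarrow> _)"
  by unfold_locales (simp_all add: smult_add_right smult_add_left)

locale minimally_generated_semigroup =
  fixes S G :: "nat set"
  assumes sg: "numerical_semigroup S" and gens: "minimally_generates G S"
begin

abbreviation "Ap \<equiv> apery_set S (Min G)"
abbreviation "od \<equiv> sg_ord G"

lemma finG: "finite G" and S_eq: "S = {(\<Sum>g\<in>G. c g * g) |c :: nat \<Rightarrow> nat. True}"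
  using gens by (auto simp: minimally_generates_def generated_submonoid_def)

lemma S_comb: "(\<Sum>g\<in>G. c g * g) \<in> S"
  unfolding S_eq by blast

lemma S_add: "a \<in> S \<Longrightarrow> b \<in> S \<Longrightarrow> a + b \<in> S" and S_0: "0 \<in> S"
  using sg by (auto simp: numerical_semigroup_def)

lemma minimal:
  assumes "g \<in> G" shows "g \<noteq> (\<Sum>h\<in>G - {g}. c h * h)"
proof
  assume g: "g = (\<Sum>h\<in>G - {g}. c h * h)"
  have "generated_submonoid (G - {g}) = S"
  proof (rule set_eqI iffI)+
    fix s assume "s \<in> generated_submonoid (G - {g})"
    then obtain d where "s = (\<Sum>h\<in>G - {g}. d h * h)" by (auto simp: generated_submonoid_def)
    also have "\<dots> = (\<Sum>h\<in>G. (if h = g then 0 else d h) * h)"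
      using finG assms by (simp add: sum.remove[of G g])
    finally show "s \<in> S" using S_comb by metis
  next
    fix s assume "s \<in> S"
    then obtain d where "s = (\<Sum>h\<in>G. d h * h)" unfolding S_eq by blast
    also have "\<dots> = d g * g + (\<Sum>h\<in>G - {g}. d h * h)"
      using finG assms by (simp add: sum.remove[of G g])
    also have "d g * g = (\<Sum>h\<in>G - {g}. d g * c h * h)"
      by (subst g) (simp add: sum_distrib_left mult.assoc)
    also have "\<dots> + (\<Sum>h\<in>G - {g}. d h * h) = (\<Sum>h\<in>G - {g}. (d g * c h + d h) * h)"
      by (simp add: sum.distrib algebra_simps)
    finally show "s \<in> generated_submonoid (G - {g})"
      by (auto simp: generated_submonoid_def intro!: exI[of _ "\<lambda>h. d g * c h + d h"])
  qed
  moreover have "G - {g} \<subset> G" using assms by blast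
  ultimately show False using gens by (auto simp: minimally_generates_def)
qed

lemma G_pos: "g \<in> G \<Longrightarrow> g > 0"
  using minimal[of g "\<lambda>_. 0"] by auto

lemma G_nonempty: "G \<noteq> {}"
proof
  assume "G = {}"
  then have "S = {0}" unfolding S_eq by auto
  then show False using sg by (auto simp: numerical_semigroup_def)
qed

lemma Min_in: "Min G \<in> G" using finG G_nonempty by simp

lemma gen_comb: "g \<in> G \<Longrightarrow> (\<Sum>h\<in>G. (if h = g then 1 else 0) * h) = g"
  using finG by (simp add: sum.remove[of G g])

lemma G_sub: "g \<in> G \<Longrightarrow> g \<in> S"
  using gen_comb S_comb by metis

lemma le_comb: "(\<Sum>g\<in>G. c g) \<le> (\<Sum>g\<in>G. c g * g)"
  by (rule sum_mono) (use G_pos in \<open>simp add: Suc_le_eq\<close>)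

lemma ord_finite: "finite {(\<Sum>g\<in>G. c g) |c :: nat \<Rightarrow> nat. s = (\<Sum>g\<in>G. c g * g)}"
  by (rule finite_subset[of _ "{..s}"]) (use le_comb in auto)

lemma ord_ge: "(\<Sum>g\<in>G. c g) \<le> od (\<Sum>g\<in>G. c g * g)"
  unfolding sg_ord_def using ord_finite by (intro Max_ge) auto

lemma ord_attained:
  assumes "s \<in> S"
  obtains c where "s = (\<Sum>g\<in>G. c g * g)" "od s = (\<Sum>g\<in>G. c g)"
proof -
  have "od s \<in> {(\<Sum>g\<in>G. c g) |c :: nat \<Rightarrow> nat. s = (\<Sum>g\<in>G. c g * g)}"
    unfolding sg_ord_def using assms by (intro Max_in ord_finite) (auto simp: S_eq)
  then show thesis using that by auto
qed

lemma ord_super: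
  assumes "a \<in> S" "b \<in> S" shows "od a + od b \<le> od (a + b)"
proof -
  obtain c where c: "a = (\<Sum>g\<in>G. c g * g)" "od a = (\<Sum>g\<in>G. c g)"
    using ord_attained[OF assms(1)] .
  obtain d where d: "b = (\<Sum>g\<in>G. d g * g)" "od b = (\<Sum>g\<in>G. d g)"
    using ord_attained[OF assms(2)] .
  have "a + b = (\<Sum>g\<in>G. (c g + d g) * g)"
    unfolding c(1) d(1) by (simp add: sum.distrib algebra_simps)
  moreover have "od a + od b = (\<Sum>g\<in>G. c g + d g)"
    unfolding c(2) d(2) by (simp add: sum.distrib)
  ultimately show ?thesis using ord_ge[of "\<lambda>g. c g + d g"] by simp
qed

lemma ord_0: "od 0 = 0"
  using ord_attained[OF S_0] finG G_pos by (metis le_comb le_zero_eq)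

lemma ord_eq_0: "s \<in> S \<Longrightarrow> od s = 0 \<Longrightarrow> s = 0"
  by (erule ord_attained) (use finG in simp)

lemma ord_split:
  assumes "s \<in> S" "od s = Suc i"
  obtains g s' where "g \<in> G" "s' \<in> S" "s = g + s'" "od g = 1" "od s' = i"
proof -
  obtain c where c: "s = (\<Sum>g\<in>G. c g * g)" "od s = (\<Sum>g\<in>G. c g)"
    using ord_attained[OF assms(1)] .
  have "\<exists>g\<in>G. c g \<noteq> 0" using c(2) assms(2) finG by (metis Zero_not_Suc sum.neutral)
  then obtain g where g: "g \<in> G" "c g \<noteq> 0" by blast
  define d where "d = c(g := c g - 1)"
  have eq: "c h = d h + (if h = g then 1 else 0)" for h using g by (simp add: d_def)
  have s: "s = g + (\<Sum>h\<in>G. d h * h)"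
    unfolding c eq distrib_right sum.distrib gen_comb[OF g(1)] by simp
  have "(\<Sum>h\<in>G. d h) + 1 = Suc i"
    using assms(2) c(2) g(1) finG unfolding eq sum.distrib by simp
  then have d: "i \<le> od (\<Sum>h\<in>G. d h * h)" using ord_ge[of d] by simp
  have "1 \<le> od g" using ord_eq_0[OF G_sub[OF g(1)]] G_pos[OF g(1)] by linarith
  moreover have "od g + od (\<Sum>h\<in>G. d h * h) \<le> Suc i"
    using ord_super[OF G_sub[OF g(1)] S_comb[of d]] s assms(2) by simp
  ultimately show thesis using that[OF g(1) S_comb s] d by linarith
qed

lemma ord_gen: assumes "g \<in> G" shows "od g = 1"
proof -
  have "od g \<noteq> 0" using ord_eq_0[OF G_sub[OF assms]] G_pos[OF assms] by linarith
  then obtain i where i: "od g = Suc i" using not0_implies_Suc by blast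
  obtain h s' where h: "h \<in> G" "s' \<in> S" "g = h + s'" "od h = 1" "od s' = i"
    using ord_split[OF G_sub[OF assms] i] .
  have "h = g"
  proof (rule ccontr)
    assume hg: "h \<noteq> g"
    obtain c where c: "s' = (\<Sum>k\<in>G. c k * k)" using h(2) unfolding S_eq by blast
    have "c g * g \<le> s'" unfolding c using finG assms
      by (intro member_le_sum) auto
    then have "c g = 0" using h(3) G_pos[OF h(1)] G_pos[OF assms]
      by (metis add_gr_0 add_le_same_cancel2 bot_nat_0.extremum_uniqueI le_trans linorder_not_less mult.commute mult_le_mono2 nat_mult_1 not_less_eq_eq One_nat_def zero_less_iff_neq_zero Suc_leI)
    then have "s' = (\<Sum>k\<in>G - {g}. c k * k)"
      unfolding c using finG assms by (simp add: sum.remove[of G g])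
    moreover have "h = (\<Sum>k\<in>G - {g}. (if k = h then 1 else 0) * k)"
      using finG h(1) hg by (simp add: sum.remove[of "G - {g}" h])
    ultimately have "g = (\<Sum>k\<in>G - {g}. ((if k = h then 1 else 0) + c k) * k)"
      using h(3) unfolding distrib_right sum.distrib by simp
    then show False
      using minimal[OF assms, of "\<lambda>k. (if k = h then 1 else 0) + c k"] by contradiction
  qed
  then show ?thesis using h by simp
qed

lemma Ap_S: "w \<in> Ap \<Longrightarrow> w \<in> S" by (simp add: apery_set_def)

lemma Ap_iff: "w \<in> Ap \<longleftrightarrow> w \<in> S \<and> (\<forall>u\<in>S. w \<noteq> Min G + u)"
  unfolding apery_set_def by (force simp: image_iff)

lemma Ap_0: "0 \<in> Ap"
  using S_0 G_pos[OF Min_in] by (auto simp: Ap_iff)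

lemma Ap_left: "u \<in> S \<Longrightarrow> v \<in> S \<Longrightarrow> u + v \<in> Ap \<Longrightarrow> u \<in> Ap"
  unfolding Ap_iff by (metis S_add add.assoc)

lemma Ap_right: "u \<in> S \<Longrightarrow> v \<in> S \<Longrightarrow> u + v \<in> Ap \<Longrightarrow> v \<in> Ap"
  using Ap_left[of v u] by (simp add: add.commute)

lemma Ap_finite: "finite Ap"
proof -
  have "Ap \<subseteq> {..<Min G} \<union> (\<lambda>x. Min G + x) ` (- S)"
  proof
    fix w assume w: "w \<in> Ap"
    show "w \<in> {..<Min G} \<union> (\<lambda>x. Min G + x) ` (- S)"
    proof (cases "w < Min G")
      case False
      then have "w = Min G + (w - Min G)" by simp
      moreover have "w - Min G \<notin> S" using w calculation unfolding Ap_iff by metis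
      ultimately show ?thesis by blast
    qed simp
  qed
  then show ?thesis using sg by (auto simp: numerical_semigroup_def intro: finite_subset)
qed

lemma Ap_ord_1: "{w \<in> Ap. od w = 1} = G - {Min G}"
proof (intro set_eqI iffI)
  fix w assume w: "w \<in> {w \<in> Ap. od w = 1}"
  then obtain g s' where g: "g \<in> G" "s' \<in> S" "w = g + s'" "od s' = 0"
    using ord_split[of w 0 thesis] Ap_S[of w] by auto
  then have "w = g" using ord_eq_0 by simp
  moreover have "w \<noteq> Min G" using w S_0 by (force simp: Ap_iff)
  ultimately show "w \<in> G - {Min G}" using g by simp
next
  fix w assume w: "w \<in> G - {Min G}"
  have "w \<in> Ap" unfolding Ap_iff
  proof (intro conjI ballI notI)
    show "w \<in> S" using w G_sub by simp
    fix u assume u: "u \<in> S" "w = Min G + u"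
    then have "od u \<noteq> 0" using ord_eq_0 w by force
    then show False
      using ord_super[OF G_sub[OF Min_in] u(1)] u(2) w ord_gen[OF Min_in] ord_gen[of w] by simp
  qed
  then show "w \<in> {w \<in> Ap. od w = 1}" using w ord_gen by simp
qed


subsection \<open>The product\<close>

interpretation V: vector_space "smult :: 'k::field \<Rightarrow> _" by (rule vector_space_smult)

definition compat :: "nat \<Rightarrow> nat \<Rightarrow> bool" where
  "compat u v \<longleftrightarrow> u + v \<in> Ap \<and> od (u + v) = od u + od v"

definition compm :: "nat \<Rightarrow> nat \<Rightarrow> 'k::field" where
  "compm u v = (if compat u v then 1 else 0)"

lemma prod_eq:
  "apery_prod S G p q =
     (\<Sum>u\<in>Ap. \<Sum>v\<in>Ap. monom (coeff p u * coeff q v * compm u v) (u + v))"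
  unfolding apery_prod_def compm_def compat_def by (intro sum.cong refl) auto

lemma prod_add_l: "apery_prod S G (p + p') q = apery_prod S G p q + apery_prod S G p' q"
  by (simp add: prod_eq algebra_simps sum.distrib flip: add_monom)

lemma prod_comm: "apery_prod S G p q = apery_prod S G q p"
  unfolding prod_eq
  by (subst sum.swap) (simp add: compm_def compat_def mult.commute add.commute)

lemma prod_add_r: "apery_prod S G q (p + p') = apery_prod S G q p + apery_prod S G q p'"
  by (metis prod_comm prod_add_l)

lemma prod_scale_l: "apery_prod S G (smult c p) q = smult c (apery_prod S G p q)"
  by (simp add: prod_eq V.scale_sum_right smult_monom mult.assoc)

lemma prod_scale_r: "apery_prod S G q (smult c p) = smult c (apery_prod S G q p)"
  by (metis prod_comm prod_scale_l)

lemma prod_0_l: "apery_prod S G 0 q = 0"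
  by (simp add: prod_eq)

lemma prod_0_r: "apery_prod S G q 0 = 0"
  by (simp add: prod_eq)

lemma prod_monom:
  assumes "u \<in> Ap" "v \<in> Ap"
  shows "apery_prod S G (monom 1 u) (monom (1::'k::field) v) = (if compat u v then monom 1 (u + v) else 0)"
proof -
  have "apery_prod S G (monom 1 u) (monom (1 :: 'k) v) =
      (\<Sum>x\<in>Ap. \<Sum>y\<in>Ap. if y = v then if x = u then monom (compm u v) (u + v) else 0 else 0)"
    unfolding prod_eq by (intro sum.cong refl) auto
  also have "\<dots> = monom (compm u v) (u + v)"
    using assms Ap_finite by simp
  finally show ?thesis by (simp add: compm_def)
qed

lemma compat_assoc:
  assumes "u \<in> Ap" "v \<in> Ap" "w \<in> Ap"
  shows "compat u v \<and> compat (u + v) w \<longleftrightarrow>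
    u + v + w \<in> Ap \<and> od (u + v + w) = od u + od v + od w"
  unfolding compat_def
  using ord_super[OF Ap_S Ap_S, OF assms(1,2)]
    ord_super[OF S_add[OF Ap_S Ap_S, OF assms(1,2)] Ap_S, OF assms(3)]
    Ap_left[OF S_add[OF Ap_S Ap_S, OF assms(1,2)] Ap_S, OF assms(3)]
  by linarith

lemma compat_assoc':
  assumes "u \<in> Ap" "v \<in> Ap" "w \<in> Ap"
  shows "compat v w \<and> compat u (v + w) \<longleftrightarrow> compat u v \<and> compat (u + v) w"
  using compat_assoc[OF assms] compat_assoc[OF assms(2,3,1)]
  by (simp add: compat_def add_ac)

lemma prod_assoc_monom:
  assumes "u \<in> Ap" "v \<in> Ap" "w \<in> Ap"
  shows "apery_prod S G (apery_prod S G (monom 1 u) (monom 1 v)) (monom 1 w) =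
    apery_prod S G (monom 1 u) (apery_prod S G (monom 1 v) (monom (1::'k::field) w))"
proof -
  have *: "compat x y \<Longrightarrow> x + y \<in> Ap" for x y by (simp add: compat_def)
  show ?thesis
    using compat_assoc'[OF assms] assms *
    by (auto simp: prod_monom prod_0_l prod_0_r add.assoc)
qed

definition carr :: "'k::field poly set" where
  "carr = V.span (monom 1 ` Ap)"

lemma component_eq:
  "apery_component S G i = V.span (monom (1::'k::field) ` {w \<in> Ap. od w = i})"
proof -
  have "{monom 1 w |w. w \<in> Ap \<and> od w = i} = monom (1::'k) ` {w \<in> Ap. od w = i}" by auto
  then show ?thesis by (simp add: apery_component_def)
qed

lemma span_components: "V.span (\<Union>i. apery_component S G i) = carr"
proof
  show "V.span (\<Union>i. apery_component S G i) \<subseteq> carr"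
    unfolding carr_def component_eq
    by (intro V.span_minimal V.subspace_span UN_least V.span_mono) auto
  show "carr \<subseteq> V.span (\<Union>i. apery_component S G i)"
    unfolding carr_def
  proof (rule V.span_mono, safe)
    fix w assume "w \<in> Ap"
    then show "monom 1 w \<in> (\<Union>i. apery_component S G i)"
      unfolding component_eq by (intro UN_I[of "od w"] V.span_base) auto
  qed
qed

lemma component_coeff:
  assumes "p \<in> apery_component S G i" "coeff p n \<noteq> 0" shows "n \<in> Ap \<and> od n = i"
proof -
  let ?Z = "{p. \<forall>n. \<not> (n \<in> Ap \<and> od n = i) \<longrightarrow> coeff p n = 0}"
  have "V.subspace ?Z" by (auto simp: V.subspace_def)
  then have "apery_component S G i \<subseteq> ?Z"
    unfolding component_eq by (intro V.span_minimal) auto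
  then show ?thesis using assms by blast
qed

lemma prod_assoc_carr:
  assumes "x \<in> carr" "y \<in> carr" "z \<in> carr"
  shows "apery_prod S G (apery_prod S G x y) z = apery_prod S G x (apery_prod S G y z)"
proof -
  note lin = V.subspace_def prod_add_l prod_add_r prod_scale_l prod_scale_r prod_0_l prod_0_r
  let ?a = "\<lambda>x y z. apery_prod S G (apery_prod S G x y) z = apery_prod S G x (apery_prod S G y z)"
  have 1: "?a (monom 1 u) (monom 1 v) z" if "u \<in> Ap" "v \<in> Ap" for u v
    using assms(3) unfolding carr_def
    by (rule V.span_induct) (use that prod_assoc_monom in \<open>auto simp: lin\<close>)
  have 2: "?a (monom 1 u) y z" if "u \<in> Ap" for u
    using assms(2) unfolding carr_def
    by (rule V.span_induct) (use that 1 in \<open>auto simp: lin\<close>)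
  show ?thesis
    using assms(1) unfolding carr_def
    by (rule V.span_induct) (use 2 in \<open>auto simp: lin\<close>)
qed

lemma one_prod_carr: "x \<in> carr \<Longrightarrow> apery_prod S G 1 x = x"
  unfolding carr_def
proof (induction x rule: V.span_induct)
  case base
  show ?case by (auto simp: V.subspace_def prod_add_r prod_scale_r prod_0_r)
next
  case (step x)
  then obtain w where "w \<in> Ap" "x = monom 1 w" by blast
  then show ?case
    using Ap_0 by (simp add: prod_monom compat_def ord_0 flip: monom_eq_1)
qed

lemma prod_component_mem:
  fixes x y :: "'k::field poly"
  assumes "x \<in> apery_component S G i" "y \<in> apery_component S G j"
  shows "apery_prod S G x y \<in> apery_component S G (i + j)"
proof -
  have sub: "V.subspace (apery_component S G k :: 'k poly set)" for k unfolding component_eq by simp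
  note lin = V.subspace_def prod_add_l prod_add_r prod_scale_l prod_scale_r prod_0_l prod_0_r
  have 1: "apery_prod S G (monom 1 u) y \<in> apery_component S G (i + j)"
    if u: "u \<in> Ap" "od u = i" for u
    using assms(2) unfolding component_eq[of j]
  proof (induction y rule: V.span_induct)
    case base
    show ?case using sub[of "i + j"] by (auto simp: lin)
  next
    case (step y)
    then obtain v where v: "v \<in> Ap" "od v = j" "y = monom 1 v" by blast
    show ?case
    proof (cases "compat u v")
      case True
      then show ?thesis
        using u v unfolding component_eq
        by (auto simp: prod_monom compat_def intro!: V.span_base)
    next
      case False
      then show ?thesis
        using u v V.subspace_0[OF sub[of "i + j"]] by (simp add: prod_monom)
    qed
  qed
  show ?thesis
    using assms(1) unfolding component_eq[of i]
  proof (induction x rule: V.span_induct)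
    case base
    show ?case using sub[of "i + j"] by (auto simp: lin)
  qed (use 1 in auto)
qed

theorem apery_algebra:
  "standard_graded_artinian_algebra (smult :: 'k::field \<Rightarrow> _)
     (apery_prod S G) 1 (apery_component S G)"
proof (unfold_locales, unfold span_components)
  show "V.subspace (apery_component S G i)" for i
    unfolding component_eq by simp
  show "x i = 0"
    if x: "\<And>i. i \<le> n \<Longrightarrow> x i \<in> apery_component S G i" "(\<Sum>i\<le>n. x i) = 0" "i \<le> n"
    for x :: "nat \<Rightarrow> 'k poly" and n i
  proof (rule poly_eqI, rule ccontr)
    fix m assume m: "coeff (x i) m \<noteq> coeff 0 m"
    have "0 = (\<Sum>j\<le>n. coeff (x j) m)"
      using arg_cong[OF x(2), of "\<lambda>p. coeff p m"] by (simp add: coeff_sum)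
    also have "\<dots> = (\<Sum>j\<in>{i}. coeff (x j) m)"
      using x(3) component_coeff[OF x(1)[OF x(3)], of m] m component_coeff[OF x(1)]
      by (intro sum.mono_neutral_right) auto
    finally show False using m by simp
  qed
  show "\<exists>B. finite B \<and> apery_component S G i \<subseteq> V.span B" for i
    unfolding component_eq using Ap_finite
    by (intro exI[of _ "monom 1 ` {w \<in> Ap. od w = i}"]) simp
  show "\<exists>n. \<forall>i\<ge>n. apery_component S G i = {0 :: 'k poly}"
  proof (intro exI allI impI)
    fix i assume i: "Suc (Max (od ` Ap)) \<le> i"
    have "od w \<le> Max (od ` Ap)" if "w \<in> Ap" for w using that Ap_finite by simp
    then have "{w \<in> Ap. od w = i} = {}" using i by force
    then show "apery_component S G i = {0 :: 'k poly}"
      unfolding component_eq by (simp only: image_empty V.span_empty)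
  qed
  show "apery_component S G 0 = V.span {1 :: 'k poly}"
  proof -
    have "{w \<in> Ap. od w = 0} = {0}" using Ap_0 ord_0 ord_eq_0 Ap_S by blast
    then show ?thesis unfolding component_eq by (simp flip: monom_eq_1)
  qed
  show "(apery_component S G (Suc i) :: 'k poly set) =
      V.span {apery_prod S G x y |x y. x \<in> apery_component S G 1 \<and> y \<in> apery_component S G i}"
    (is "_ = V.span ?P") for i
  proof
    have "?P \<subseteq> apery_component S G (Suc i)"
      using prod_component_mem[of _ 1 _ i] by auto
    then show "V.span ?P \<subseteq> apery_component S G (Suc i)"
      unfolding component_eq[of "Suc i"] by (intro V.span_minimal) auto
    show "apery_component S G (Suc i) \<subseteq> V.span ?P"
      unfolding component_eq[of "Suc i"]
    proof (intro V.span_mono image_subsetI)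
      fix w assume "w \<in> {w \<in> Ap. od w = Suc i}"
      then have w: "w \<in> Ap" "od w = Suc i" by auto
      obtain g s where g: "g \<in> G" "s \<in> S" "w = g + s" "od g = 1" "od s = i"
        using ord_split[OF Ap_S[OF w(1)] w(2)] .
      have ap: "g \<in> Ap" "s \<in> Ap"
        using Ap_left[of g s] Ap_right[of g s] g G_sub w by auto
      have "monom 1 w = apery_prod S G (monom 1 g) (monom (1::'k) s)"
        using g w by (simp add: prod_monom[OF ap] compat_def)
      moreover have "monom (1::'k) g \<in> apery_component S G 1" "monom (1::'k) s \<in> apery_component S G i"
        unfolding component_eq using ap g by (auto intro!: V.span_base)
      ultimately show "monom 1 w \<in> ?P" by blast
    qed
  qed
qed (use prod_component_mem prod_add_l prod_scale_l prod_assoc_carr prod_comm one_prod_carr in auto)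

theorem apery_codimension:
  "vector_space.dim (smult :: 'k::field \<Rightarrow> _) (apery_component S G 1) = card G - 1"
proof -
  let ?B = "monom (1::'k) ` (G - {Min G})"
  have fin: "finite ?B" using finG by simp
  have inj: "inj_on (monom (1::'k)) (G - {Min G})" by (auto simp: inj_on_def monom_eq_iff')
  have "V.independent ?B"
    unfolding V.dependent_finite[OF fin]
  proof (intro notI, elim exE conjE bexE)
    fix u v assume v: "v \<in> ?B" "u v \<noteq> 0" and z: "(\<Sum>v\<in>?B. smult (u v) v) = 0"
    obtain w where w: "w \<in> G - {Min G}" "v = monom 1 w" using v by blast
    have "0 = (\<Sum>x\<in>G - {Min G}. coeff (monom (u (monom 1 x)) x) w)"
      using arg_cong[OF z, of "\<lambda>p. coeff p w"] inj
      by (simp add: sum.reindex coeff_sum smult_monom)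
    also have "\<dots> = u v" using w finG by (simp add: coeff_monom)
    finally show False using v by simp
  qed
  then have "V.dim (V.span ?B) = card ?B" by (rule V.dim_span_eq_card_independent)
  also have "\<dots> = card G - 1" using card_image[OF inj] Min_in finG by simp
  finally show ?thesis unfolding component_eq Ap_ord_1 .
qed

end

end

theory Submission
  imports "Jordan_Normal_Form.Determinant" Defs
begin

text \<open>
  Let \<open>m < a < b < c\<close> be the generators and \<open>x, y, z\<close> the classes of \<open>t\<^sup>a, t\<^sup>b, t\<^sup>c\<close>. The only homogeneous
  binomial relation is \<open>y^(p+r) = x^p z^r\<close>, where \<open>p : r = (c - b) : (b - a)\<close> in lowest terms. If \<open>A\<close> is
  Gorenstein, every Apery element extends to one top element, which has a unique representation
  \<open>x^as y^bs z^cs\<close> of maximal length with \<open>bs < p + r\<close>. The monomials with \<open>y\<close>-exponent below \<open>p + r\<close>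
  that represent the Apery elements then form the box \<open>[0,as] \<times> [0,bs] \<times> [0,cs]\<close> together with the
  box \<open>[0,as-p] \<times> (bs,p+r) \<times> [0,cs-r]\<close>, and both are symmetric about the same degree
  \<open>(as+bs+cs)/2\<close>.

  For \<open>\<ell> = x + e y + z\<close> and a basis rescaled by powers of \<open>e\<close>, multiplication by \<open>\<ell>\<close> has coefficient \<open>1\<close>
  inside each box, while the two links between the boxes carry positive powers of \<open>e\<close>. At \<open>e = 0\<close> the
  boxes decouple, each carries an \<open>sl\<^sub>2\<close>-action in characteristic zero, and the powers of \<open>\<ell>\<close> between
  symmetric degrees are bijective. Their determinants are polynomials in \<open>e\<close>, so the same holds for all
  but finitely many \<open>e\<close>.
\<close>

section \<open>Generic bijectivity of a polynomial family\<close>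

text \<open>Enumerating \<open>I\<close> and \<open>J\<close> turns the family into a square matrix
  over the polynomials, and \<open>d\<close> is its determinant. Evaluation commutes with
  determinants, so injectivity at \<open>0\<close> makes \<open>d\<close> nonzero, and the matrix is
  invertible wherever \<open>d\<close> does not vanish.\<close>

lemma generically_bijective:
  fixes M :: "'a \<Rightarrow> 'b \<Rightarrow> 'k::field poly"
  assumes fin: "finite I" "finite J" and card: "card I = card J"
    and inj: "\<And>f. \<forall>j\<in>J. (\<Sum>i\<in>I. f i * poly (M i j) 0) = 0 \<Longrightarrow> \<forall>i\<in>I. f i = 0"
  shows "\<exists>d :: 'k poly. d \<noteq> 0 \<and> (\<forall>e. poly d e \<noteq> 0 \<longrightarrow>
    (\<forall>f. (\<forall>j\<in>J. (\<Sum>i\<in>I. f i * poly (M i j) e) = 0) \<longrightarrow> (\<forall>i\<in>I. f i = 0)) \<and>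
    (\<forall>g. \<exists>f. \<forall>j\<in>J. (\<Sum>i\<in>I. f i * poly (M i j) e) = g j))"
proof -
  define n where "n = card I"
  obtain a where a: "bij_betw a {0..<n} I"
    using ex_bij_betw_nat_finite[OF fin(1)] n_def by auto
  obtain b where b: "bij_betw b {0..<n} J"
    using ex_bij_betw_nat_finite[OF fin(2)] n_def card by auto
  define P where "P = mat n n (\<lambda>(r, c). M (a c) (b r))"
  define Q where "Q e = map_mat (\<lambda>p. poly p e) P" for e
  have P: "P \<in> carrier_mat n n" and Q: "Q e \<in> carrier_mat n n" for e
    by (auto simp: P_def Q_def)
  have det: "det (Q e) = poly (det P) e" for e
  proof -
    interpret comm_ring_hom "\<lambda>p. poly p e" by unfold_locales auto
    show ?thesis unfolding Q_def by simp
  qed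
  define F where "F f = vec n (\<lambda>c. f (a c) :: 'k)" for f
  have row: "(Q e *\<^sub>v F f) $ r = (\<Sum>i\<in>I. f i * poly (M i (b r)) e)" if "r < n" for e f r
  proof -
    have "(\<Sum>i\<in>I. f i * poly (M i (b r)) e) = (\<Sum>c\<in>{0..<n}. f (a c) * poly (M (a c) (b r)) e)"
      by (rule sum.reindex_bij_betw[OF a, symmetric])
    then show ?thesis
      using that by (simp add: Q_def P_def F_def scalar_prod_def mult.commute)
  qed
  have vec_F: "\<exists>f. v = F f" if "v \<in> carrier_vec n" for v
  proof (rule exI[of _ "\<lambda>i. v $ (the_inv_into {0..<n} a i)"])
    show "v = F (\<lambda>i. v $ (the_inv_into {0..<n} a i))"
      using that a unfolding F_def
      by (intro eq_vecI) (auto simp: bij_betw_def the_inv_into_f_f)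
  qed
  have F_0: "F f = 0\<^sub>v n \<longleftrightarrow> (\<forall>i\<in>I. f i = 0)" for f
  proof -
    have "F f = 0\<^sub>v n \<longleftrightarrow> (\<forall>c\<in>{0..<n}. f (a c) = 0)"
      unfolding F_def by (auto simp: vec_eq_iff)
    also have "\<dots> \<longleftrightarrow> (\<forall>i\<in>a ` {0..<n}. f i = 0)" by simp
    finally show ?thesis using a unfolding bij_betw_def by metis
  qed
  have kernel: "Q e *\<^sub>v F f = 0\<^sub>v n \<longleftrightarrow> (\<forall>j\<in>J. (\<Sum>i\<in>I. f i * poly (M i j) e) = 0)" for e f
  proof -
    have "Q e *\<^sub>v F f = 0\<^sub>v n \<longleftrightarrow> (\<forall>r<n. (Q e *\<^sub>v F f) $ r = 0)"
      using Q by (auto simp: vec_eq_iff)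
    also have "\<dots> \<longleftrightarrow> (\<forall>r\<in>{0..<n}. (\<Sum>i\<in>I. f i * poly (M i (b r)) e) = 0)"
      using row by auto
    also have "\<dots> \<longleftrightarrow> (\<forall>j\<in>b ` {0..<n}. (\<Sum>i\<in>I. f i * poly (M i j) e) = 0)"
      by simp
    finally show ?thesis using b unfolding bij_betw_def by metis
  qed
  have "det (Q 0) \<noteq> 0"
  proof
    assume "det (Q 0) = 0"
    then obtain v where v: "v \<in> carrier_vec n" "v \<noteq> 0\<^sub>v n" "Q 0 *\<^sub>v v = 0\<^sub>v n"
      using det_0_iff_vec_prod_zero_field[OF Q] by blast
    obtain f where "v = F f" using vec_F[OF v(1)] by blast
    then show False using v inj kernel F_0 by metis
  qed
  then have 1: "det P \<noteq> 0" using det by auto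
  have 2: "\<forall>i\<in>I. f i = 0"
    if "poly (det P) e \<noteq> 0" "\<forall>j\<in>J. (\<Sum>i\<in>I. f i * poly (M i j) e) = 0" for e f
  proof -
    have "F f \<in> carrier_vec n" by (simp add: F_def)
    moreover have "Q e *\<^sub>v F f = 0\<^sub>v n" using that(2) kernel by blast
    ultimately show ?thesis
      using that(1) det_0_iff_vec_prod_zero_field[OF Q, of e] det[of e] F_0 by metis
  qed
  have 3: "\<exists>f. \<forall>j\<in>J. (\<Sum>i\<in>I. f i * poly (M i j) e) = g j" if "poly (det P) e \<noteq> 0" for e g
  proof -
    have "Q e \<in> Units (ring_mat TYPE('k) n ())"
      using det_non_zero_imp_unit[OF Q] that det by metis
    then obtain R where R: "R \<in> carrier_mat n n" "Q e * R = 1\<^sub>m n"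
      by (auto simp: Units_def ring_mat_def)
    define w where "w = vec n (\<lambda>r. g (b r))"
    have w: "w \<in> carrier_vec n" by (simp add: w_def)
    have "R *\<^sub>v w \<in> carrier_vec n" using R(1) w by simp
    then obtain f where f: "R *\<^sub>v w = F f" using vec_F by blast
    have "Q e *\<^sub>v F f = w"
      unfolding f[symmetric] using assoc_mult_mat_vec[OF Q R(1) w] R(2) w by (metis one_mult_mat_vec)
    then have "\<forall>r\<in>{0..<n}. (\<Sum>i\<in>I. f i * poly (M i (b r)) e) = g (b r)"
      using row[of _ e f] by (auto simp: w_def)
    then have "\<forall>j\<in>b ` {0..<n}. (\<Sum>i\<in>I. f i * poly (M i j) e) = g j" by simp
    then show ?thesis using b unfolding bij_betw_def by metis
  qed
  show ?thesis using 1 2 3 by blast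
qed

text \<open>The degree \<open>i\<close> part of the space with basis \<open>T\<close>, as coordinate
  functions extended by zero, so that equality of vectors is equality of functions.\<close>

definition supported :: "('x \<Rightarrow> nat) \<Rightarrow> 'x set \<Rightarrow> nat \<Rightarrow> ('x \<Rightarrow> 'r::zero) set" where
  "supported deg T i = {f. \<forall>u. f u \<noteq> 0 \<longrightarrow> u \<in> T \<and> deg u = i}"

section \<open>Two boxes with a common centre\<close>

locale sl2_action =
  fixes deg :: "'x \<Rightarrow> nat" and T :: "'x set" and n :: nat
    and E F :: "('x \<Rightarrow> 'k::field_char_0) \<Rightarrow> 'x \<Rightarrow> 'k"
  assumes E_supported: "f \<in> supported deg T i \<Longrightarrow> E f \<in> supported deg T (Suc i)"
    and F_supported: "f \<in> supported deg T (Suc i) \<Longrightarrow> F f \<in> supported deg T i"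
    and F_bottom: "f \<in> supported deg T 0 \<Longrightarrow> F f = (\<lambda>_. 0)"
    and E_add: "E (\<lambda>u. f u + g u) = (\<lambda>u. E f u + E g u)"
    and E_scale: "E (\<lambda>u. c * f u) = (\<lambda>u. c * E f u)"
    and F_0: "F (\<lambda>_. 0) = (\<lambda>_. 0)"
    and commutator:
      "f \<in> supported deg T i \<Longrightarrow> F (E f) u = E (F f) u + of_int (int n - 2 * int i) * f u"
begin

lemma E_0: "E (\<lambda>_. 0) = (\<lambda>_. 0)"
  using E_scale[of 0 "\<lambda>_. 0"] by simp

lemma E_pow_0: "(E ^^ j) (\<lambda>_. 0) = (\<lambda>_. 0)"
  by (induction j) (simp_all add: E_0)

lemma E_pow_supported: "f \<in> supported deg T i \<Longrightarrow> (E ^^ j) f \<in> supported deg T (i + j)"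
  by (induction j) (simp_all add: E_supported)

text \<open>The commutators met in degrees \<open>i, ..., i + j\<close> add up: the sum of
  \<open>n - 2 * (i + k)\<close> over \<open>k \<le> j\<close> is
  \<open>(j + 1) * (n - 2 * i - j)\<close>.\<close>

lemma F_E_pow:
  assumes f: "f \<in> supported deg T i"
  shows "F ((E ^^ Suc j) f) =
    (\<lambda>u. (E ^^ Suc j) (F f) u + of_int (int (Suc j) * (int n - 2 * int i - int j)) * (E ^^ j) f u)"
proof (induction j)
  case 0
  show ?case using commutator[OF f] by auto
next
  case (Suc j)
  have "F ((E ^^ Suc (Suc j)) f) u = E (F ((E ^^ Suc j) f)) u
      + of_int (int n - 2 * int (i + Suc j)) * (E ^^ Suc j) f u" for u
    using commutator[OF E_pow_supported[OF f, of "Suc j"], of u] by simp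
  also have "\<dots> u = (E ^^ Suc (Suc j)) (F f) u
      + of_int (int (Suc (Suc j)) * (int n - 2 * int i - int (Suc j))) * (E ^^ Suc j) f u" for u
    unfolding Suc E_add E_scale by (simp add: algebra_simps)
  finally show ?case by blast
qed

text \<open>Outer induction on the degree, inner on the power. Applying \<open>F\<close> to
  \<open>E^(j+1) f = 0\<close> gives \<open>E^(j+1) (F f) + c * E^j f = 0\<close>. One more
  \<open>E\<close> kills the second term, so \<open>F f\<close>, one degree lower, vanishes by the
  outer hypothesis; then \<open>E^j f = 0\<close> because \<open>c \<noteq> 0\<close>.\<close>

lemma E_pow_injective:
  "f \<in> supported deg T i \<Longrightarrow> j + 2 * i \<le> n \<Longrightarrow> (E ^^ j) f = (\<lambda>_. 0) \<Longrightarrow> f = (\<lambda>_. 0)"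
proof (induction i arbitrary: f j)
  case i: (0 f j)
  from i(2,3) show ?case
  proof (induction j)
    case (Suc j)
    have "(\<lambda>u. of_int (int (Suc j) * (int n - int j)) * (E ^^ j) f u) = (\<lambda>_. 0)"
      using F_E_pow[OF i(1), of j] unfolding F_bottom[OF i(1)] E_pow_0 Suc.prems(2) F_0 by simp
    moreover have "int (Suc j) * (int n - int j) \<noteq> 0" using Suc.prems(1) by simp
    ultimately have "(E ^^ j) f = (\<lambda>_. 0)" by (simp add: fun_eq_iff del: of_int_mult)
    then show ?case using Suc by simp
  qed simp
next
  case i: (Suc i f j)
  from i(3,4) show ?case
  proof (induction j)
    case (Suc j)
    define c :: 'k where "c = of_int (int (Suc j) * (int n - 2 * int (Suc i) - int j))"
    \<comment> \<open>The bound on the power keeps the second factor at least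
      \<open>1\<close>.\<close>
    have c: "c \<noteq> 0" using Suc.prems(1) unfolding c_def of_int_eq_0_iff by simp
    have eq: "(\<lambda>u. (E ^^ Suc j) (F f) u + c * (E ^^ j) f u) = (\<lambda>_. 0)"
      using F_E_pow[OF i(2), of j] unfolding Suc.prems(2) F_0 c_def by simp
    have "(E ^^ Suc (Suc j)) (F f) = (\<lambda>_. 0)"
      using arg_cong[OF eq, of E] Suc.prems(2) unfolding E_add E_scale E_0 by (simp add: fun_eq_iff)
    then have "F f = (\<lambda>_. 0)"
      using i(1)[OF F_supported[OF i(2)], of "Suc (Suc j)"] Suc.prems(1) by simp
    then have "(E ^^ j) f = (\<lambda>_. 0)"
      using eq c unfolding \<open>F f = _\<close> E_pow_0 by (simp add: fun_eq_iff)
    then show ?case using Suc by simp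
  qed simp
qed

end

section \<open>Raising and lowering on the two boxes\<close>

locale two_boxes =
  fixes as bs cs p r :: nat
  assumes p_pos: "0 < p" and r_pos: "0 < r" and bs_less: "bs < p + r"
begin

text \<open>The second box holds the divisors with \<open>bs < y < p + r\<close> of the exchanged
  top \<open>x^(as-p) y^(bs+p+r) z^(cs-r)\<close>. Its bounds are additive, so it is empty when
  \<open>as < p\<close> or \<open>cs < r\<close>.\<close>

definition T :: "(nat \<times> nat \<times> nat) set" where
  "T = {(x, y, z). y \<le> bs \<and> x \<le> as \<and> z \<le> cs} \<union>
       {(x, y, z). bs < y \<and> y < p + r \<and> x + p \<le> as \<and> z + r \<le> cs}"

lemma T_iff: "(x, y, z) \<in> T \<longleftrightarrow>
    y \<le> bs \<and> x \<le> as \<and> z \<le> cs \<or> bs < y \<and> y < p + r \<and> x + p \<le> as \<and> z + r \<le> cs"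
  by (auto simp: T_def)

fun deg :: "nat \<times> nat \<times> nat \<Rightarrow> nat" where
  "deg (x, y, z) = x + y + z"

text \<open>The exponent of \<open>e\<close> in the rescaling of the basis; the value \<open>y - 1\<close> in the second box makes
  both links between the boxes vanish at \<open>e = 0\<close>.\<close>
definition shift :: "nat \<Rightarrow> nat" where
  "shift y = (if y \<le> bs then y else y - 1)"

text \<open>Multiplication by \<open>x + e y + z\<close> in the rescaled basis, collected over
  predecessors. Since \<open>y^(p+r) = x^p z^r\<close>, a monomial with \<open>y\<close>-exponent
  \<open>0\<close> can have a predecessor with \<open>y\<close>-exponent \<open>p + r - 1\<close>.
  The ring is arbitrary so that \<open>e\<close> can be a polynomial variable.\<close>

fun ell :: "'r::comm_ring_1 \<Rightarrow> (nat \<times> nat \<times> nat \<Rightarrow> 'r) \<Rightarrow> nat \<times> nat \<times> nat \<Rightarrow> 'r" where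
  "ell e f (x, y, z) = (if (x, y, z) \<in> T then
      (if x = 0 then 0 else f (x - 1, y, z)) + (if z = 0 then 0 else f (x, y, z - 1)) +
      (if y = 0 then
         if p \<le> x \<and> r \<le> z then e ^ Suc (shift (p + r - 1)) * f (x - p, p + r - 1, z - r) else 0
       else (if y = Suc bs then e else 1) * f (x, y - 1, z))
     else 0)"

text \<open>On a chain with vertices \<open>lo, ..., hi\<close>, raising \<open>k\<close> to \<open>k + 1\<close> with coefficient \<open>1\<close> and lowering
  \<open>k + 1\<close> to \<open>k\<close> with coefficient \<open>(k + 1 - lo) * (hi - k)\<close> have commutator \<open>lo + hi - 2 * k\<close>; the operator
  below is the sum over the three directions.\<close>
fun lower :: "(nat \<times> nat \<times> nat \<Rightarrow> 'r::comm_ring_1) \<Rightarrow> nat \<times> nat \<times> nat \<Rightarrow> 'r" where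
  "lower f (x, y, z) = (if (x, y, z) \<in> T then
      if y \<le> bs then
        of_nat (Suc x * (as - x)) * f (Suc x, y, z) + of_nat (Suc z * (cs - z)) * f (x, y, Suc z) +
        of_nat (Suc y * (bs - y)) * f (x, Suc y, z)
      else
        of_nat (Suc x * (as - p - x)) * f (Suc x, y, z) +
        of_nat (Suc z * (cs - r - z)) * f (x, y, Suc z) +
        of_nat ((y - bs) * (p + r - 1 - y)) * f (x, Suc y, z)
     else 0)"

text \<open>At \<open>e = 0\<close> the links vanish and each box is a product of three chains,
  whose commutators add. In the second box the chains are \<open>[0, as-p]\<close>,
  \<open>[bs+1, p+r-1]\<close> and \<open>[0, cs-r]\<close>, and their ends again sum to
  \<open>as + bs + cs\<close>.\<close>

lemma commutator:
  fixes f :: "nat \<times> nat \<times> nat \<Rightarrow> 'k::field_char_0"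
  assumes f: "f \<in> supported deg T i"
  shows "lower (ell 0 f) u = ell 0 (lower f) u + of_int (int (as + bs + cs) - 2 * int i) * f u"
proof (cases "u \<in> T")
  case False
  then have "f u = 0" using f unfolding supported_def by blast
  then show ?thesis using False by (cases u) simp
next
  case True
  obtain x y z where u: "u = (x, y, z)" by (cases u)
  \<comment> \<open>The index \<open>i\<close> may be replaced by the degree of \<open>u\<close>,
    since \<open>f u\<close> vanishes unless the two agree.\<close>
  have i: "of_int (int (as + bs + cs) - 2 * int i) * f u =
      of_int (int (as + bs + cs) - 2 * int (x + y + z)) * f u"
  proof (cases "f u = 0")
    case False
    then have "deg u = i" using f unfolding supported_def by blast
    then show ?thesis by (simp add: u)
  qed simp
  show ?thesis
  proof (cases "y \<le> bs")
    case y: True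
    \<comment> \<open>Slack variables remove the truncated subtractions; which coordinates and
      slacks are \<open>0\<close> decides which neighbours lie in the box.\<close>
    obtain k l m where k: "as = x + k" "bs = y + l" "cs = z + m"
      using True y unfolding u T_iff by (auto simp: le_iff_add)
    show ?thesis
      unfolding i unfolding u ell.simps lower.simps T_iff power_0_Suc mult_zero_left
      by (cases x; cases y; cases z; cases k; cases l; cases m;
          simp add: k algebra_simps)
  next
    case y: False
    \<comment> \<open>Here \<open>y'\<close> and \<open>l\<close> are the distances of
      \<open>y\<close> from the ends \<open>bs + 1\<close> and \<open>p + r - 1\<close> of its
      chain.\<close>
    obtain k l m y' where k: "as = p + (x + k)" "p + r = Suc (y + l)" "cs = r + (z + m)"
        "y = Suc (bs + y')"
      using True y unfolding u T_iff
      by (auto simp: le_iff_add less_iff_Suc_add add_ac)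
    have sum: "as + bs + cs = x + k + (bs + Suc (y + l)) + (z + m)" using k by simp
    have le: "a + p \<le> as \<longleftrightarrow> a \<le> x + k" "a + r \<le> cs \<longleftrightarrow> a \<le> z + m" for a using k by auto
    have diff: "as - p - a = x + k - a" "cs - r - a = z + m - a" for a using k by auto
    show ?thesis
      unfolding i unfolding u ell.simps lower.simps T_iff power_0_Suc mult_zero_left le diff sum k(2)
      by (cases x; cases y'; cases z; cases k; cases l; cases m; simp add: k(4) algebra_simps)
  qed
qed

end

section \<open>Maximal rank for generic parameter\<close>

context two_boxes
begin

lemma finite_T: "finite T"
  by (rule finite_subset[of _ "{..as} \<times> {..p + r + bs} \<times> {..cs}"]) (auto simp: T_def)

lemma ell_supported:
  assumes "f \<in> supported deg T i" shows "ell e f \<in> supported deg T (Suc i)"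
  unfolding supported_def mem_Collect_eq
proof (intro allI impI)
  fix u assume nz: "ell e f u \<noteq> 0"
  obtain x y z where u: "u = (x, y, z)" by (cases u)
  have u_T: "u \<in> T" using nz unfolding u by (auto split: if_splits)
  have f: "f (a, b, c) \<noteq> 0 \<Longrightarrow> a + b + c = i" for a b c
    using assms unfolding supported_def by fastforce
  have "x > 0 \<and> f (x - 1, y, z) \<noteq> 0 \<or> z > 0 \<and> f (x, y, z - 1) \<noteq> 0 \<or>
      y > 0 \<and> f (x, y - 1, z) \<noteq> 0 \<or>
      y = 0 \<and> p \<le> x \<and> r \<le> z \<and> f (x - p, p + r - 1, z - r) \<noteq> 0"
    using nz unfolding u by (auto split: if_splits)
  then have "x + y + z = Suc i"
    using p_pos by (elim disjE conjE; drule_tac f) auto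
  then show "u \<in> T \<and> deg u = Suc i" using u_T u by simp
qed

lemma ell_pow_supported:
  "f \<in> supported deg T i \<Longrightarrow> (ell e ^^ j) f \<in> supported deg T (i + j)"
  by (induction j) (simp_all add: ell_supported)

lemma lower_supported:
  assumes "f \<in> supported deg T (Suc i)" shows "lower f \<in> supported deg T i"
  unfolding supported_def mem_Collect_eq
proof (intro allI impI)
  fix u assume nz: "lower f u \<noteq> 0"
  obtain x y z where u: "u = (x, y, z)" by (cases u)
  have u_T: "u \<in> T" using nz unfolding u by (auto split: if_splits)
  have f: "f (a, b, c) \<noteq> 0 \<Longrightarrow> a + b + c = Suc i" for a b c
    using assms unfolding supported_def by fastforce
  have "f (Suc x, y, z) \<noteq> 0 \<or> f (x, Suc y, z) \<noteq> 0 \<or> f (x, y, Suc z) \<noteq> 0"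
    using nz unfolding u by (auto split: if_splits)
  then have "x + y + z = i" by (elim disjE; drule_tac f) auto
  then show "u \<in> T \<and> deg u = i" using u_T u by simp
qed

lemma ell_add: "ell e (\<lambda>u. f u + g u) = (\<lambda>u. ell e f u + ell e g u)"
  by (rule ext, rename_tac u, case_tac u) (simp add: algebra_simps)

lemma ell_scale: "ell e (\<lambda>u. c * f u) = (\<lambda>u. c * ell e f u)"
  by (rule ext, rename_tac u, case_tac u) (simp add: algebra_simps)

lemma ell_0: "ell e (\<lambda>_. 0) = (\<lambda>_. 0)"
  using ell_scale[of e 0 "\<lambda>_. 0"] by simp

lemma ell_sum: "ell e (\<lambda>u. \<Sum>v\<in>I. c v * g v u) = (\<lambda>u. \<Sum>v\<in>I. c v * ell e (g v) u)"
  by (induction I rule: infinite_finite_induct) (simp_all add: ell_0 ell_add ell_scale)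

lemma ell_pow_sum:
  "(ell e ^^ j) (\<lambda>u. \<Sum>v\<in>I. c v * g v u) = (\<lambda>u. \<Sum>v\<in>I. c v * (ell e ^^ j) (g v) u)"
  by (induction j) (simp_all add: ell_sum)

lemma poly_ell: "poly (ell a f u) e = ell (poly a e) (\<lambda>u. poly (f u) e) u"
  by (cases u) simp

text \<open>With the polynomial variable for \<open>a\<close>, this makes the matrix entries of the
  powers of \<open>ell e\<close> polynomials in \<open>e\<close>.\<close>

lemma poly_ell_pow:
  "poly ((ell a ^^ j) f u) e = (ell (poly a e) ^^ j) (\<lambda>u. poly (f u) e) u"
  by (induction j arbitrary: u) (simp_all add: poly_ell)

sublocale sl2_action deg T "as + bs + cs"
  "ell 0 :: (nat \<times> nat \<times> nat \<Rightarrow> 'k::field_char_0) \<Rightarrow> _" lower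
proof
  fix f :: "nat \<times> nat \<times> nat \<Rightarrow> 'k"
  assume f: "f \<in> supported deg T 0"
  have "f (a, b, c) = 0" if "a + b + c \<noteq> 0" for a b c
    using f that unfolding supported_def by fastforce
  then show "lower f = (\<lambda>_. 0)"
    by (intro ext, rename_tac u, case_tac u) simp
next
  show "lower (\<lambda>_. 0 :: 'k) = (\<lambda>_. 0)"
    by (intro ext, rename_tac u, case_tac u) simp
qed (simp_all only: ell_supported lower_supported ell_add ell_scale commutator)

text \<open>The map \<open>h\<close> reflects each box in its centre. In the second box
  \<open>y\<close> runs over \<open>bs + 1, ..., p + r - 1\<close>, whose ends add up to
  \<open>bs + (p + r)\<close>.\<close>

lemma card_degree:
  assumes "i \<le> as + bs + cs"
  shows "card {u \<in> T. deg u = i} = card {u \<in> T. deg u = as + bs + cs - i}"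
proof -
  define h where "h = (\<lambda>(x, y, z). if y \<le> bs then (as - x, bs - y, cs - z)
    else (as - p - x, bs + (p + r) - y, cs - r - z))"
  have h: "h u \<in> T \<and> deg (h u) = as + bs + cs - deg u \<and> deg u \<le> as + bs + cs \<and> h (h u) = u"
    if "u \<in> T" for u
    using that by (cases u) (auto simp: h_def T_iff)
  have "bij_betw h {u \<in> T. deg u = i} {u \<in> T. deg u = as + bs + cs - i}"
    by (rule bij_betw_byWitness[where f' = h]) (use h assms in auto)
  then show ?thesis by (rule bij_betw_same_card)
qed

definition bijective_at :: "'k::field_char_0 \<Rightarrow> nat \<Rightarrow> bool" where
  "bijective_at e i \<longleftrightarrow>
     (\<forall>f\<in>supported deg T i. (ell e ^^ (as + bs + cs - 2 * i)) f = (\<lambda>_. 0) \<longrightarrow> f = (\<lambda>_. 0)) \<and>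
     (\<forall>g\<in>supported deg T (as + bs + cs - i). \<exists>f\<in>supported deg T i.
        (ell e ^^ (as + bs + cs - 2 * i)) f = g)"

lemma generically_bijective_at:
  assumes i: "2 * i \<le> as + bs + cs"
  shows "\<exists>d :: 'k::field_char_0 poly. d \<noteq> 0 \<and> (\<forall>e. poly d e \<noteq> 0 \<longrightarrow> bijective_at e i)"
proof -
  define N where "N = as + bs + cs - 2 * i"
  define I where "I = {u \<in> T. deg u = i}"
  define J where "J = {u \<in> T. deg u = as + bs + cs - i}"
  have fin: "finite I" "finite J" unfolding I_def J_def using finite_T by auto
  have card: "card I = card J" unfolding I_def J_def using i by (intro card_degree) simp
  define \<delta> :: "nat \<times> nat \<times> nat \<Rightarrow> nat \<times> nat \<times> nat \<Rightarrow> 'k poly"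
    where "\<delta> v = (\<lambda>u. if v = u then 1 else 0)" for v
  \<comment> \<open>The coefficient at \<open>u\<close> of the image of the basis vector
    \<open>v\<close>, with the variable \<open>[:0, 1:]\<close> in place of
    \<open>e\<close>.\<close>
  define M where "M v u = (ell [:0, 1:] ^^ N) (\<delta> v) u" for v u
  \<comment> \<open>The basis vectors are constant polynomials, so evaluation at \<open>0\<close>
    only turns them into scalars; \<open>ext f\<close> is \<open>f\<close> cut off outside
    \<open>I\<close>.\<close>
  define ext where "ext f = (\<lambda>u. \<Sum>v\<in>I. f v * poly (\<delta> v u) 0)" for f :: "_ \<Rightarrow> 'k"
  have \<delta>: "poly (\<delta> v u) e = poly (\<delta> v u) 0" for v u e by (simp add: \<delta>_def)
  have ext: "ext f = (\<lambda>u. if u \<in> I then f u else 0)" for f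

  proof (rule HOL.ext)
    fix u
    have "f v * poly (\<delta> v u) 0 = (if v = u then f v else 0)" for v by (simp add: \<delta>_def)
    then show "ext f u = (if u \<in> I then f u else 0)" unfolding ext_def using fin(1) by simp
  qed
  have ext_supported: "ext f \<in> supported deg T i" for f
    unfolding ext supported_def by (auto simp: I_def)
  have ext_id: "ext f = f" if "f \<in> supported deg T i" for f
  proof (rule HOL.ext)
    fix u
    have "u \<in> I" if "f u \<noteq> 0" using that \<open>f \<in> _\<close> unfolding supported_def I_def by blast
    then show "ext f u = f u" unfolding ext by (cases "f u = 0") simp_all
  qed
  have M: "(\<Sum>v\<in>I. f v * poly (M v u) e) = (ell e ^^ N) (ext f) u" for f u e
    unfolding M_def poly_ell_pow ext_def ell_pow_sum \<delta>[of _ _ e] by simp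
  have N: "i + N = as + bs + cs - i" unfolding N_def using i by simp
  have pow_J: "(ell e ^^ N) (ext f) \<in> supported deg T (as + bs + cs - i)" for e f
    using ell_pow_supported[OF ext_supported, where e = e and j = N] unfolding N .
  have eq: "(ell e ^^ N) (ext f) = g \<longleftrightarrow> (\<forall>u\<in>J. (ell e ^^ N) (ext f) u = g u)"
    if "g \<in> supported deg T (as + bs + cs - i)" for e f g
  proof
    assume *: "\<forall>u\<in>J. (ell e ^^ N) (ext f) u = g u"
    show "(ell e ^^ N) (ext f) = g"
    proof (rule HOL.ext)
      fix u
      have 0: "h u = 0" if "u \<notin> J" "h \<in> supported deg T (as + bs + cs - i)" for h :: "_ \<Rightarrow> 'k"
        using that unfolding supported_def J_def by blast
      show "(ell e ^^ N) (ext f) u = g u"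
        using * 0[OF _ that] 0[OF _ pow_J] by (cases "u \<in> J") simp_all
    qed
  qed simp
  have zero: "(\<lambda>_. 0) \<in> supported deg T k" for k by (simp add: supported_def)
  have kernel: "\<forall>v\<in>I. f v = 0" if "\<forall>u\<in>J. (\<Sum>v\<in>I. f v * poly (M v u) 0) = 0" for f
  proof -
    have "(ell 0 ^^ N) (ext f) = (\<lambda>_. 0)" using that unfolding M eq[OF zero] .
    then have "ext f = (\<lambda>_. 0)"
      using E_pow_injective[OF ext_supported, of N f] i by (simp add: N_def)
    then have "ext f v = 0" for v by simp
    then show ?thesis unfolding ext by metis
  qed
  have "\<exists>d. d \<noteq> 0 \<and> (\<forall>e. poly d e \<noteq> 0 \<longrightarrow>
      (\<forall>f. (\<forall>u\<in>J. (\<Sum>v\<in>I. f v * poly (M v u) e) = 0) \<longrightarrow> (\<forall>v\<in>I. f v = 0)) \<and>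
      (\<forall>g. \<exists>f. \<forall>u\<in>J. (\<Sum>v\<in>I. f v * poly (M v u) e) = g u))"
    by (rule generically_bijective[OF fin card]) (erule kernel)
  then obtain d where d: "d \<noteq> 0" and
    d': "\<forall>e. poly d e \<noteq> 0 \<longrightarrow>
      (\<forall>f. (\<forall>u\<in>J. (\<Sum>v\<in>I. f v * poly (M v u) e) = 0) \<longrightarrow> (\<forall>v\<in>I. f v = 0)) \<and>
      (\<forall>g. \<exists>f. \<forall>u\<in>J. (\<Sum>v\<in>I. f v * poly (M v u) e) = g u)"
    by (elim exE conjE)
  have "bijective_at e i" if e: "poly d e \<noteq> 0" for e
    unfolding bijective_at_def N_def[symmetric]
  proof (intro conjI ballI impI)
    fix f :: "_ \<Rightarrow> 'k" assume f: "f \<in> supported deg T i" "(ell e ^^ N) f = (\<lambda>_. 0)"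
    have "\<forall>u\<in>J. (\<Sum>v\<in>I. f v * poly (M v u) e) = 0"
      unfolding M ext_id[OF f(1)] f(2) by simp
    then have "\<forall>v\<in>I. f v = 0" using d' e by blast
    then have "ext f = (\<lambda>_. 0)" unfolding ext by (intro HOL.ext) simp
    then show "f = (\<lambda>_. 0)" using ext_id[OF f(1)] by simp
  next
    fix g :: "_ \<Rightarrow> 'k" assume g: "g \<in> supported deg T (as + bs + cs - i)"
    obtain f where "\<forall>u\<in>J. (\<Sum>v\<in>I. f v * poly (M v u) e) = g u" using d' e by blast
    then have "(ell e ^^ N) (ext f) = g" unfolding M eq[OF g] .
    then show "\<exists>f\<in>supported deg T i. (ell e ^^ N) f = g" using ext_supported by blast
  qed
  then show ?thesis using d by blast
qed

text \<open>Injectivity into the symmetric degree passes to shorter powers out of \<open>i\<close>, surjectivity out of the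
  symmetric degree to shorter powers into \<open>i + j\<close>.\<close>
lemma maximal_rank_from_bijective:
  fixes e :: "'k::field_char_0"
  assumes bij: "\<And>i. 2 * i \<le> as + bs + cs \<Longrightarrow> bijective_at e i"
  shows "(\<forall>f\<in>supported deg T i. (ell e ^^ j) f = (\<lambda>_. 0) \<longrightarrow> f = (\<lambda>_. 0)) \<or>
    (\<forall>g\<in>supported deg T (i + j). \<exists>f\<in>supported deg T i. (ell e ^^ j) f = g)"
proof (cases "2 * i + j \<le> as + bs + cs")
  case True
  have "f = (\<lambda>_. 0)" if f: "f \<in> supported deg T i" "(ell e ^^ j) f = (\<lambda>_. 0)" for f :: "_ \<Rightarrow> 'k"
  proof -
    have "(ell e ^^ k) (\<lambda>_. 0 :: 'k) = (\<lambda>_. 0)" for k by (induction k) (simp_all add: ell_0)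
    then have "(ell e ^^ (as + bs + cs - 2 * i - j + j)) f = (\<lambda>_. 0)"
      unfolding funpow_add comp_def f(2) .
    then show ?thesis using bij[of i] True f(1) unfolding bijective_at_def by simp
  qed
  then show ?thesis by blast
next
  case False
  show ?thesis
  proof (intro disjI2 ballI)
    fix g :: "_ \<Rightarrow> 'k" assume g: "g \<in> supported deg T (i + j)"
    show "\<exists>f\<in>supported deg T i. (ell e ^^ j) f = g"
    proof (cases "i + j \<le> as + bs + cs")
      case True
      \<comment> \<open>The degree symmetric to \<open>i + j\<close> lies below \<open>i\<close>
        because \<open>2 * i + j > as + bs + cs\<close>, so the bijective power starting there
        passes through degree \<open>i\<close>.\<close>
      define i' where "i' = as + bs + cs - (i + j)"
      have i': "2 * i' \<le> as + bs + cs" "as + bs + cs - i' = i + j" "i' \<le> i"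
        "as + bs + cs - 2 * i' = j + (i - i')"
        unfolding i'_def using True False by auto
      then obtain f where f: "f \<in> supported deg T i'" "(ell e ^^ (j + (i - i'))) f = g"
        using bij[of i'] g unfolding bijective_at_def by metis
      have "(ell e ^^ (i - i')) f \<in> supported deg T i"
        using ell_pow_supported[OF f(1), where e = e and j = "i - i'"] i'(3) by simp
      then show ?thesis using f(2) unfolding funpow_add comp_def by blast
    next
      case False
      have "deg u \<le> as + bs + cs" if "u \<in> T" for u using that by (cases u) (auto simp: T_iff)
      then have "g = (\<lambda>_. 0)" using g False unfolding supported_def by (intro ext) fastforce
      moreover have "(ell e ^^ j) (\<lambda>_. 0 :: 'k) = (\<lambda>_. 0)" by (induction j) (simp_all add: ell_0)
      moreover have "(\<lambda>_. 0 :: 'k) \<in> supported deg T i" by (simp add: supported_def)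
      ultimately show ?thesis by blast
    qed
  qed
qed

text \<open>Only finitely many degrees have \<open>2 * i \<le> n\<close>, so a product of their
  polynomials serves all \<open>i\<close> and \<open>j\<close>.\<close>

lemma generic_maximal_rank:
  "\<exists>d :: 'k::field_char_0 poly. d \<noteq> 0 \<and> (\<forall>e. poly d e \<noteq> 0 \<longrightarrow> (\<forall>i j.
      (\<forall>f\<in>supported deg T i. (ell e ^^ j) f = (\<lambda>_. 0) \<longrightarrow> f = (\<lambda>_. 0)) \<or>
      (\<forall>g\<in>supported deg T (i + j). \<exists>f\<in>supported deg T i. (ell e ^^ j) f = g)))"
proof -
  define n where "n = as + bs + cs"
  have "\<forall>i. \<exists>d :: 'k poly. d \<noteq> 0 \<and> (2 * i \<le> n \<longrightarrow> (\<forall>e. poly d e \<noteq> 0 \<longrightarrow> bijective_at e i))"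
    using generically_bijective_at unfolding n_def by (metis zero_neq_one)
  then obtain d :: "nat \<Rightarrow> 'k poly" where d: "\<And>i. d i \<noteq> 0"
      "\<And>i e. 2 * i \<le> n \<Longrightarrow> poly (d i) e \<noteq> 0 \<Longrightarrow> bijective_at e i"
    by metis
  show ?thesis
  proof (intro exI[of _ "\<Prod>i\<le>n. d i"] conjI allI impI)
    show "(\<Prod>i\<le>n. d i) \<noteq> 0" using d(1) by simp
    fix e i j assume "poly (\<Prod>i\<le>n. d i) e \<noteq> 0"
    then have "poly (d i) e \<noteq> 0" if "i \<le> n" for i using that by (simp add: poly_prod)
    then have "bijective_at e i" if "2 * i \<le> as + bs + cs" for i
      using that by (intro d(2)) (auto simp: n_def)
    then show "(\<forall>f\<in>supported deg T i. (ell e ^^ j) f = (\<lambda>_. 0) \<longrightarrow> f = (\<lambda>_. 0)) \<or>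
      (\<forall>g\<in>supported deg T (i + j). \<exists>f\<in>supported deg T i. (ell e ^^ j) f = g)"
      by (rule maximal_rank_from_bijective)
  qed
qed

end

section \<open>Maximal representations of Apery elements\<close>

context minimally_generated_semigroup
begin

text \<open>Here \<open>compat v w\<close> says that \<open>t^v\<close> times \<open>t^w\<close> is
  nonzero, so these monomials are annihilated by every \<open>t^v\<close> with
  \<open>v \<noteq> 0\<close>.\<close>

definition maximal :: "nat \<Rightarrow> bool" where
  "maximal w \<longleftrightarrow> w \<in> Ap \<and> (\<forall>v\<in>Ap. compat v w \<longrightarrow> v = 0)"

lemma compat_commute: "compat u v \<longleftrightarrow> compat v u"
  by (simp add: compat_def add.commute)

lemma compat_trans:
  assumes "u \<in> Ap" "v \<in> Ap" "w \<in> Ap" "compat u v" "compat (u + v) w"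
  shows "compat v w" "compat u (v + w)"
  using compat_assoc'[OF assms(1-3)] assms(4,5) by blast+

text \<open>A nonzero compatible summand strictly raises the order, which is bounded on the finite
  Apery set.\<close>

lemma maximal_above:
  assumes "v \<in> Ap"
  shows "\<exists>v'\<in>Ap. compat v v' \<and> maximal (v + v')"
  using assms
proof (induction "Max (od ` Ap) - od v" arbitrary: v rule: less_induct)
  case less
  show ?case
  proof (cases "maximal v")
    case True
    then show ?thesis using less.prems Ap_0 by (intro bexI[of _ 0]) (auto simp: compat_def ord_0)
  next
    case False
    then obtain u where u: "u \<in> Ap" "compat u v" "u \<noteq> 0"
      using less.prems unfolding maximal_def by blast
    have uv: "v + u \<in> Ap" "compat v u" "od (v + u) = od v + od u"
      using u(2) compat_commute unfolding compat_def by (auto simp: add.commute)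
    have "od u \<noteq> 0" using ord_eq_0[OF Ap_S[OF u(1)]] u(3) by blast
    moreover have "od (v + u) \<le> Max (od ` Ap)" using uv(1) Ap_finite by simp
    ultimately have "Max (od ` Ap) - od (v + u) < Max (od ` Ap) - od v" using uv(3) by linarith
    then obtain v' where v': "v' \<in> Ap" "compat (v + u) v'" "maximal (v + u + v')"
      using less.hyps uv(1) by blast
    have "compat u v'" "compat v (u + v')"
      using compat_trans[OF less.prems u(1) v'(1) uv(2) v'(2)] .
    moreover from this have "u + v' \<in> Ap" by (auto simp: compat_def)
    ultimately show ?thesis using v'(3) by (auto simp: add.assoc)
  qed
qed

text \<open>The annihilator of \<open>t^w\<close> is a subspace, so testing monomials of positive
  order suffices, and these have \<open>v \<noteq> 0\<close>.\<close>

lemma monom_maximal_in_socle: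
  assumes "maximal w"
  shows "monom 1 w \<in> standard_graded_artinian_algebra.socle
    (smult :: 'k::field \<Rightarrow> _) (apery_prod S G) (apery_component S G)"
proof -
  interpret A: standard_graded_artinian_algebra "smult :: 'k \<Rightarrow> _" "apery_prod S G" 1
    "apery_component S G" by (rule apery_algebra)
  have w: "w \<in> Ap" using assms by (simp add: maximal_def)
  have "monom 1 w \<in> A.algebra_carrier"
    unfolding A.algebra_carrier_def span_components carr_def using w by (intro A.span_base) auto
  moreover have "apery_prod S G x (monom 1 w) = 0" if "x \<in> A.irrelevant_ideal" for x
  proof -
    let ?Z = "{x :: 'k poly. apery_prod S G x (monom 1 w) = 0}"
    have Z: "A.subspace ?Z" by (auto simp: A.subspace_def prod_0_l prod_add_l prod_scale_l)
    have "monom 1 v \<in> ?Z" if "v \<in> Ap" "od v = i" "i \<ge> 1" for v i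
    proof -
      have "v \<noteq> 0" using that ord_0 by (cases "v = 0") auto
      then have "\<not> compat v w" using assms that(1) unfolding maximal_def by blast
      then show ?thesis using prod_monom[OF that(1) w] by simp
    qed
    then have "apery_component S G i \<subseteq> ?Z" if "i \<in> {1..}" for i
      unfolding component_eq using that by (intro A.span_minimal[OF _ Z]) auto
    then have "A.irrelevant_ideal \<subseteq> ?Z"
      unfolding A.irrelevant_ideal_def by (intro A.span_minimal[OF _ Z]) blast
    then show ?thesis using that by blast
  qed
  ultimately show ?thesis unfolding A.socle_def by blast
qed

text \<open>Two different maximal elements would put two independent monomials into a
  one-dimensional socle. Hence \<open>maximal_above\<close> reaches the same \<open>w\<close> from
  every \<open>v\<close>.\<close>

lemma gorenstein_top:
  assumes "standard_graded_artinian_algebra.gorenstein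
    (smult :: 'k::field \<Rightarrow> _) (apery_prod S G) (apery_component S G)"
  obtains w where "w \<in> Ap" "\<forall>v\<in>Ap. \<exists>v'\<in>Ap. compat v v' \<and> v + v' = w"
proof -
  interpret A: standard_graded_artinian_algebra "smult :: 'k \<Rightarrow> _" "apery_prod S G" 1
    "apery_component S G" by (rule apery_algebra)
  have unique: "w = w'" if w: "maximal w" "maximal w'" for w w'
  proof -
    obtain B where B: "A.socle \<subseteq> A.span B" "card B = 1"
      using A.basis_exists[of A.socle] assms[unfolded A.gorenstein_def] by metis
    then obtain x where x: "B = {x}" using card_1_singletonE by blast
    have "monom 1 w \<in> A.span {x}" "monom 1 w' \<in> A.span {x}"
      using monom_maximal_in_socle w B x by blast+
    then obtain k k' where k: "monom 1 w = smult k x" "monom 1 w' = smult k' x"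
      unfolding A.span_singleton by blast
    \<comment> \<open>The first and third equations make \<open>coeff x w\<close> and
      \<open>k'\<close> nonzero, which forces \<open>w' = w\<close> in the second.\<close>
    have "k * coeff x w = 1" "k' * coeff x w = (if w' = w then 1 else 0)" "k' * coeff x w' = 1"
      using arg_cong[OF k(1), of "\<lambda>p. coeff p w"] arg_cong[OF k(2), of "\<lambda>p. coeff p w"]
        arg_cong[OF k(2), of "\<lambda>p. coeff p w'"] by simp_all
    then show ?thesis by (metis mult_eq_0_iff zero_neq_one)
  qed
  obtain w where w: "maximal w" using maximal_above[OF Ap_0] by blast
  show thesis
  proof (rule that)
    show "w \<in> Ap" using w by (simp add: maximal_def)
    show "\<forall>v\<in>Ap. \<exists>v'\<in>Ap. compat v v' \<and> v + v' = w"
      using maximal_above unique[OF _ w] by blast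
  qed
qed

end

section \<open>Four generators and the exchange relation\<close>

lemma multiple_less_one:
  fixes t q y y' :: int
  assumes "y = y' + t * q" "y < q" "0 \<le> y'" "0 \<le> q"
  shows "t < 1"
proof (rule ccontr)
  assume "\<not> t < 1"
  then have "1 * q \<le> t * q" using assms(4) by (intro mult_right_mono) auto
  then show False using assms by linarith
qed

locale four_generated = minimally_generated_semigroup +
  fixes m a b c g p r :: nat
  assumes G: "G = {m, a, b, c}" and m_less: "m < a"
    and b_eq: "b = a + g * r" and c_eq: "c = b + g * p"
    and g_pos: "0 < g" and p_pos: "0 < p" and r_pos: "0 < r" and coprime: "coprime p r"
begin

lemma less: "a < b" "b < c"
  using b_eq c_eq g_pos p_pos r_pos by simp_all

lemma Min_G: "Min G = m"
  using G less m_less by simp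

text \<open>The exponents of the monomials in the classes of \<open>t^a, t^b, t^c\<close> that are
  nonzero in the algebra.\<close>

definition maxrep :: "nat \<Rightarrow> nat \<Rightarrow> nat \<Rightarrow> bool" where
  "maxrep x y z \<longleftrightarrow> a * x + b * y + c * z \<in> Ap \<and> od (a * x + b * y + c * z) = x + y + z"

lemma sum_G: "(\<Sum>h\<in>G. f h) = f m + f a + f b + f c" for f :: "nat \<Rightarrow> nat"
  using m_less less unfolding G by simp

lemma comb_S: "a * x + b * y + c * z \<in> S"
  using S_comb[of "\<lambda>h. if h = a then x else if h = b then y else if h = c then z else 0"]
    m_less less unfolding sum_G by (simp add: mult.commute)

lemma le_ord: "x + y + z \<le> od (a * x + b * y + c * z)"
  using ord_ge[of "\<lambda>h. if h = a then x else if h = b then y else if h = c then z else 0"]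
    m_less less unfolding sum_G by (simp add: mult.commute)

text \<open>A representation using \<open>m\<close> would put \<open>v - m\<close> into
  \<open>S\<close>, so one of maximal length involves only \<open>a, b, c\<close>.\<close>

lemma maxrep_exists:
  assumes "v \<in> Ap"
  obtains x y z where "maxrep x y z" "v = a * x + b * y + c * z"
proof -
  obtain k where k: "v = (\<Sum>h\<in>G. k h * h)" "od v = (\<Sum>h\<in>G. k h)"
    using ord_attained[OF Ap_S[OF assms]] .
  have "k m = 0"
  proof (rule ccontr)
    assume "k m \<noteq> 0"
    then obtain n where n: "k m = Suc n" using not0_implies_Suc by blast
    have "v = m + (\<Sum>h\<in>G. (k(m := n)) h * h)"
      unfolding k(1) sum_G using m_less less n by simp
    then show False using assms S_comb unfolding Ap_iff unfolding Min_G by blast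
  qed
  then have "v = a * k a + b * k b + c * k c" "od v = k a + k b + k c"
    using k unfolding sum_G by (simp_all add: mult.commute)
  then show thesis using that assms unfolding maxrep_def by metis
qed

text \<open>The order is superadditive and at least the length of any representation, so when the
  whole attains its length, so does each part.\<close>

lemma maxrep_mono:
  assumes "maxrep x' y' z'" "x \<le> x'" "y \<le> y'" "z \<le> z'"
  shows "maxrep x y z"
proof -
  obtain i j k where ijk: "x' = x + i" "y' = y + j" "z' = z + k"
    using assms(2-4) by (auto simp: le_iff_add)
  let ?v = "a * x + b * y + c * z" and ?w = "a * i + b * j + c * k"
  have eq: "a * x' + b * y' + c * z' = ?v + ?w" unfolding ijk by (simp add: algebra_simps)
  have "?v \<in> Ap" using Ap_left[OF comb_S comb_S] assms(1) unfolding maxrep_def eq by blast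
  moreover have "od ?v + od ?w \<le> x + i + (y + j) + (z + k)"
    using ord_super[OF comb_S comb_S, of x y z i j k] assms(1) unfolding maxrep_def eq
    unfolding ijk by simp
  ultimately show ?thesis using le_ord[of x y z] le_ord[of i j k] unfolding maxrep_def by linarith
qed

lemma relation: "a * p + c * r = b * (p + r)"
  unfolding c_eq b_eq by (simp add: algebra_simps)

text \<open>Both sides of \<open>a * p + c * r = b * (p + r)\<close> have \<open>p + r\<close>
  summands, so trading one for the other \<open>k\<close> times changes neither value nor
  length.\<close>

lemma maxrep_exchange: "maxrep (x + k * p) y (z + k * r) \<longleftrightarrow> maxrep x (y + k * (p + r)) z"
proof -
  have "a * (x + k * p) + b * y + c * (z + k * r) = a * x + b * y + c * z + k * (a * p + c * r)"
    by (simp add: algebra_simps)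
  also have "\<dots> = a * x + b * (y + k * (p + r)) + c * z"
    unfolding relation by (simp add: algebra_simps)
  finally have 1: "a * (x + k * p) + b * y + c * (z + k * r)
    = a * x + b * (y + k * (p + r)) + c * z" .
  have 2: "x + k * p + y + (z + k * r) = x + (y + k * (p + r)) + z" by (simp add: algebra_simps)
  show ?thesis unfolding maxrep_def 1 2 ..
qed

text \<open>Equal values have equal order, hence equal length, which gives two linear equations for
  the differences. Eliminating \<open>Y\<close> leaves \<open>p * Z = r * X\<close>, and coprimality
  makes \<open>(X, Z)\<close> a multiple of \<open>(p, r)\<close>, possibly negative.\<close>

lemma maxrep_same_weight:
  assumes "maxrep x y z" "maxrep x' y' z'" "a * x + b * y + c * z = a * x' + b * y' + c * z'"
  obtains t :: int where "int x' = int x + t * int p" "int y = int y' + t * int (p + r)"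
    "int z' = int z + t * int r"
proof -
  have deg: "x + y + z = x' + y' + z'" using assms unfolding maxrep_def by simp
  define X Y Z where "X = int x' - int x" "Y = int y' - int y" "Z = int z' - int z"
  note XYZ = this
  have Y: "Y = - X - Z" using arg_cong[OF deg, of int] unfolding XYZ by simp
  have "int a * X + int b * Y + int c * Z = 0"
    using arg_cong[OF assms(3), of int] unfolding XYZ by (simp add: algebra_simps)
  then have "int g * (int p * Z - int r * X) = 0"
    unfolding Y c_eq b_eq by (simp add: algebra_simps)
  then have eq: "int p * Z = int r * X" using g_pos by simp
  then have "int p dvd int r * X" by (metis dvd_triv_left)
  then have "int p dvd X" using coprime by (simp add: coprime_dvd_mult_right_iff)
  then obtain t where t: "X = int p * t" by blast
  have "int p * Z = int p * (int r * t)" using eq t by simp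
  then have "Z = int r * t" using p_pos by simp
  then show thesis using that[of t] t Y unfolding XYZ by (simp add: algebra_simps)
qed

lemma maxrep_normal:
  assumes "v \<in> Ap"
  obtains x y z where "maxrep x y z" "v = a * x + b * y + c * z" "y < p + r"
proof -
  obtain x y z where u: "maxrep x y z" "v = a * x + b * y + c * z" using maxrep_exists[OF assms] .
  define k where "k = y div (p + r)"
  have y: "y = y mod (p + r) + k * (p + r)" unfolding k_def by (simp only: mod_div_mult_eq)
  have "maxrep (x + k * p) (y mod (p + r)) (z + k * r)"
    using u(1) maxrep_exchange[of x k "y mod (p + r)" z] y by simp
  moreover have "v = a * (x + k * p) + b * (y mod (p + r)) + c * (z + k * r)"
  proof -
    have "a * (x + k * p) + b * (y mod (p + r)) + c * (z + k * r)
      = a * x + b * (y mod (p + r)) + c * z + k * (a * p + c * r)" by (simp add: algebra_simps)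
    also have "\<dots> = a * x + b * (y mod (p + r) + k * (p + r)) + c * z"
      unfolding relation by (simp add: algebra_simps)
    finally show ?thesis unfolding u(2) using y by simp
  qed
  moreover have "y mod (p + r) < p + r" using p_pos by simp
  ultimately show thesis using that by blast
qed

end

section \<open>Shape of the exponent set in the Gorenstein case\<close>

locale gorenstein_four_generated = four_generated +
  fixes as bs cs :: nat
  assumes top: "maxrep as bs cs" and bs_less: "bs < p + r"
    and below_top: "v \<in> Ap \<Longrightarrow> \<exists>v'\<in>Ap. compat v v' \<and> v + v' = a * as + b * bs + c * cs"
begin

sublocale two_boxes as bs cs p r
  by unfold_locales (fact p_pos r_pos bs_less)+

text \<open>Points of the boxes divide one of two forms of the top. Conversely, joining
  \<open>v\<close> with its cofactor \<open>v'\<close> gives a maximal representation of the top,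
  hence \<open>(as, bs, cs)\<close> up to \<open>t\<close> exchanges; \<open>t = 0\<close> yields
  the first box, \<open>t < 0\<close> the bounds on \<open>x\<close> and \<open>z\<close> of the
  second.\<close>

lemma in_T_iff: "(x, y, z) \<in> T \<longleftrightarrow> maxrep x y z \<and> y < p + r"
proof
  assume "(x, y, z) \<in> T"
  then consider "y \<le> bs" "x \<le> as" "z \<le> cs" | "bs < y" "y < p + r" "x + p \<le> as" "z + r \<le> cs"
    unfolding T_iff by blast
  then show "maxrep x y z \<and> y < p + r"
  proof cases
    case 1
    then show ?thesis using maxrep_mono[OF top] bs_less by simp
  next
    case 2
    then have "maxrep (as - p) (bs + (p + r)) (cs - r)"
      using maxrep_exchange[of "as - p" 1 bs "cs - r"] top by simp
    then show ?thesis by (rule maxrep_mono[THEN conjI]) (use 2 in auto)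
  qed
next
  assume u: "maxrep x y z \<and> y < p + r"
  define v where "v = a * x + b * y + c * z"
  obtain v' where v': "v' \<in> Ap" "compat v v'" "v + v' = a * as + b * bs + c * cs"
    using below_top u unfolding maxrep_def v_def by blast
  obtain i j k where ijk: "maxrep i j k" "v' = a * i + b * j + c * k" using maxrep_exists[OF v'(1)] .
  have sum: "a * (x + i) + b * (y + j) + c * (z + k) = v + v'"
    unfolding v_def ijk(2) by (simp add: algebra_simps)
  have "od (v + v') = x + i + (y + j) + (z + k)"
    using v'(2) u ijk unfolding compat_def maxrep_def v_def by simp
  then have "maxrep (x + i) (y + j) (z + k)"
    using v'(2) unfolding maxrep_def sum compat_def by simp
  then obtain t where t: "int (x + i) = int as + t * int p" "int bs = int (y + j) + t * int (p + r)"
      "int (z + k) = int cs + t * int r"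
    using maxrep_same_weight[OF top] v'(3) sum by metis
  \<comment> \<open>A positive \<open>t\<close> would give \<open>bs \<ge> p + r\<close>.\<close>
  have "t < 1" using multiple_less_one[OF t(2)] bs_less by simp
  then consider "t = 0" | "t \<le> -1" by linarith
  then show "(x, y, z) \<in> T"
  proof cases
    case 1
    then show ?thesis using t u unfolding T_iff by auto
  next
    case 2
    then have "t * int p \<le> -1 * int p" "t * int r \<le> -1 * int r"
      by (intro mult_right_mono; simp)+
    then have "x + p \<le> as" "z + r \<le> cs" using t by linarith+
    \<comment> \<open>These bounds imply those of the first box, so \<open>y\<close> may lie on
      either side of \<open>bs\<close>.\<close>
    then show ?thesis using u unfolding T_iff by auto
  qed
qed

fun weight :: "nat \<times> nat \<times> nat \<Rightarrow> nat" where
  "weight (x, y, z) = a * x + b * y + c * z"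

lemma weight_T: "weight ` T = Ap"
proof (intro equalityI subsetI)
  fix v assume "v \<in> weight ` T"
  then show "v \<in> Ap" using in_T_iff by (auto simp: maxrep_def)
next
  fix v assume "v \<in> Ap"
  then obtain x y z where u: "maxrep x y z" "v = a * x + b * y + c * z" "y < p + r"
    using maxrep_normal by blast
  then have "weight (x, y, z) = v" "(x, y, z) \<in> T" using in_T_iff by auto
  then show "v \<in> weight ` T" by blast
qed

text \<open>A nonzero \<open>t\<close> moves the \<open>y\<close>-exponent by at least
  \<open>p + r\<close>, so normal exponents are unique; with \<open>weight_T\<close>, the set
  \<open>T\<close> indexes the monomial basis.\<close>

lemma weight_inj: "inj_on weight T"
proof (rule inj_onI)
  fix u u' assume uu': "u \<in> T" "u' \<in> T" "weight u = weight u'"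
  obtain x y z x' y' z' where u: "u = (x, y, z)" "u' = (x', y', z')" by (cases u; cases u')
  obtain t where t: "int x' = int x + t * int p" "int y = int y' + t * int (p + r)"
    "int z' = int z + t * int r"
    using maxrep_same_weight[of x y z x' y' z'] uu' in_T_iff unfolding u by auto
  have y: "y < p + r" "y' < p + r" using uu' in_T_iff unfolding u by auto
  have "int y' = int y + (- t) * int (p + r)" using t(2) by simp
  from multiple_less_one[OF this] multiple_less_one[OF t(2)] have "t = 0" using y by simp
  then show "u = u'" using t u by simp
qed

lemma ord_weight: "u \<in> T \<Longrightarrow> od (weight u) = deg u"
  by (cases u) (auto simp: in_T_iff maxrep_def)

end

section \<open>The Apery algebra in coordinates\<close>

context minimally_generated_semigroup
begin

lemma coeff_prod_monom:
  fixes P :: "'k::field poly"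
  assumes u: "u \<in> Ap"
  shows "coeff (apery_prod S G (monom 1 u) P) n =
    (if u \<le> n \<and> n - u \<in> Ap \<and> compat u (n - u) then coeff P (n - u) else 0)"
proof -
  have "apery_prod S G (monom 1 u) P =
      (\<Sum>x\<in>Ap. if x = u then \<Sum>v\<in>Ap. monom (coeff P v * compm u v) (u + v) else 0)"
    unfolding prod_eq by (intro sum.cong refl) auto
  also have "\<dots> = (\<Sum>v\<in>Ap. monom (coeff P v * compm u v) (u + v))"
    using u Ap_finite by simp
  finally have "coeff (apery_prod S G (monom 1 u) P) n =
      (\<Sum>v\<in>Ap. if u + v = n then coeff P v * compm u v else 0)"
    by (simp add: coeff_sum)
  \<comment> \<open>The guard \<open>u \<le> n\<close> excludes the false match \<open>v = 0\<close>
    produced by truncated subtraction.\<close>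
  also have "\<dots> = (\<Sum>v\<in>Ap. if v = n - u then if u \<le> n then coeff P v * compm u v else 0 else 0)"
    by (intro sum.cong refl) auto
  also have "\<dots> = (if u \<le> n \<and> n - u \<in> Ap then coeff P (n - u) * compm u (n - u) else 0)"
    using Ap_finite by simp
  finally show ?thesis by (simp add: compm_def)
qed

lemma apery_component_iff:
  fixes P :: "'k::field poly"
  shows "P \<in> apery_component S G i \<longleftrightarrow> (\<forall>n. coeff P n \<noteq> 0 \<longrightarrow> n \<in> Ap \<and> od n = i)"
proof
  interpret V: vector_space "smult :: 'k \<Rightarrow> _" by (rule vector_space_smult)
  assume *: "\<forall>n. coeff P n \<noteq> 0 \<longrightarrow> n \<in> Ap \<and> od n = i"
  have "smult (coeff P n) (monom 1 n) \<in> apery_component S G i" for n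
    using * unfolding component_eq
    by (cases "coeff P n = 0") (simp_all add: V.span_zero V.span_scale V.span_base)
  then have "(\<Sum>n\<le>degree P. smult (coeff P n) (monom 1 n)) \<in> apery_component S G i"
    unfolding component_eq by (intro V.span_sum)
  then show "P \<in> apery_component S G i"
    using poly_as_sum_of_monoms[of P] by (simp add: smult_monom)
qed (use component_coeff in blast)

end

section \<open>Multiplication in normal-form coordinates\<close>

context gorenstein_four_generated
begin

lemma gens_Ap: "a \<in> Ap" "b \<in> Ap" "c \<in> Ap" and gens_ord: "od a = 1" "od b = 1" "od c = 1"
proof -
  have "{w \<in> Ap. od w = 1} = {a, b, c}"
    unfolding Ap_ord_1 unfolding Min_G using m_less less unfolding G by auto
  then show "a \<in> Ap" "b \<in> Ap" "c \<in> Ap" "od a = 1" "od b = 1" "od c = 1" by auto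
qed

lemma compat_gens:
  assumes "maxrep x y z"
  shows "compat a (a * x + b * y + c * z) \<longleftrightarrow> maxrep (Suc x) y z"
    and "compat b (a * x + b * y + c * z) \<longleftrightarrow> maxrep x (Suc y) z"
    and "compat c (a * x + b * y + c * z) \<longleftrightarrow> maxrep x y (Suc z)"
  using assms gens_ord unfolding compat_def maxrep_def by (simp_all add: algebra_simps)

lemma T_eqI:
  assumes "(x, y, z) \<in> T" "maxrep x' y' z'" "y' < p + r"
    and "a * x + b * y + c * z = a * x' + b * y' + c * z'"
  shows "x = x'" "y = y'" "z = z'"
  using inj_onD[OF weight_inj, of "(x, y, z)" "(x', y', z')"] assms in_T_iff[of x' y' z'] by simp_all

text \<open>Multiplying by \<open>t^a\<close> leaves the \<open>y\<close>-exponent alone, so normal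
  exponents stay normal. For \<open>x = 0\<close> a predecessor would produce a second normal
  exponent of the same weight.\<close>

lemma coeff_prod_a:
  fixes P :: "'k::field poly"
  assumes T: "(x, y, z) \<in> T"
  shows "coeff (apery_prod S G (monom 1 a) P) (weight (x, y, z)) =
    (if x = 0 then 0 else coeff P (weight (x - 1, y, z)))"
proof (cases x)
  case 0
  define n where "n = weight (x, y, z)"
  have False if n: "a \<le> n" "n - a \<in> Ap" "compat a (n - a)"
  proof -
    obtain i j k where u: "maxrep i j k" "n - a = a * i + b * j + c * k" "j < p + r"
      using maxrep_normal[OF n(2)] .
    have m: "maxrep (Suc i) j k" using compat_gens(1)[OF u(1)] n(3) u(2) by simp
    have "a * x + b * y + c * z = a * Suc i + b * j + c * k"
      using n(1) u(2) unfolding n_def weight.simps mult_Suc_right by linarith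
    then show False using T_eqI(1)[OF T m u(3)] 0 by simp
  qed
  then show ?thesis unfolding coeff_prod_monom[OF gens_Ap(1)] n_def[symmetric] using 0 by auto
next
  case (Suc x')
  have m: "maxrep (Suc x') y z" "maxrep x' y z"
    using T in_T_iff maxrep_mono[of x y z x' y z] Suc by auto
  define v where "v = a * x' + b * y + c * z"
  have v: "weight (x, y, z) = a + v" "weight (x - 1, y, z) = v" by (simp_all add: Suc v_def)
  have "v \<in> Ap" "compat a v" using m compat_gens(1)[OF m(2)] by (simp_all add: maxrep_def v_def)
  then show ?thesis unfolding coeff_prod_monom[OF gens_Ap(1)] v using Suc by simp
qed

lemma coeff_prod_c:
  fixes P :: "'k::field poly"
  assumes T: "(x, y, z) \<in> T"
  shows "coeff (apery_prod S G (monom 1 c) P) (weight (x, y, z)) =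
    (if z = 0 then 0 else coeff P (weight (x, y, z - 1)))"
proof (cases z)
  case 0
  define n where "n = weight (x, y, z)"
  have False if n: "c \<le> n" "n - c \<in> Ap" "compat c (n - c)"
  proof -
    obtain i j k where u: "maxrep i j k" "n - c = a * i + b * j + c * k" "j < p + r"
      using maxrep_normal[OF n(2)] .
    have m: "maxrep i j (Suc k)" using compat_gens(3)[OF u(1)] n(3) u(2) by simp
    have "a * x + b * y + c * z = a * i + b * j + c * Suc k"
      using n(1) u(2) unfolding n_def weight.simps mult_Suc_right by linarith
    then show False using T_eqI(3)[OF T m u(3)] 0 by simp
  qed
  then show ?thesis unfolding coeff_prod_monom[OF gens_Ap(3)] n_def[symmetric] using 0 by auto
next
  case (Suc z')
  have m: "maxrep x y (Suc z')" "maxrep x y z'"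
    using T in_T_iff maxrep_mono[of x y z x y z'] Suc by auto
  define v where "v = a * x + b * y + c * z'"
  have v: "weight (x, y, z) = c + v" "weight (x, y, z - 1) = v" by (simp_all add: Suc v_def)
  have "v \<in> Ap" "compat c v" using m compat_gens(3)[OF m(2)] by (simp_all add: maxrep_def v_def)
  then show ?thesis unfolding coeff_prod_monom[OF gens_Ap(3)] v using Suc by simp
qed

text \<open>Multiplying by \<open>t^b\<close> can push \<open>y\<close> from
  \<open>p + r - 1\<close> to \<open>p + r\<close>; the exchange then returns \<open>y\<close> to
  \<open>0\<close> and adds \<open>p\<close> to \<open>x\<close> and \<open>r\<close> to
  \<open>z\<close>.\<close>

lemma coeff_prod_b:
  fixes P :: "'k::field poly"
  assumes T: "(x, y, z) \<in> T"
  shows "coeff (apery_prod S G (monom 1 b) P) (weight (x, y, z)) =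
    (if y = 0 then if p \<le> x \<and> r \<le> z then coeff P (weight (x - p, p + r - 1, z - r)) else 0
     else coeff P (weight (x, y - 1, z)))"
proof -
  define n where "n = weight (x, y, z)"
  \<comment> \<open>The exponent with \<open>Suc j\<close> may equal \<open>p + r\<close>, so this
    covers both the ordinary and the wrapped predecessor.\<close>
  have pred: "coeff (apery_prod S G (monom 1 b) P) n = coeff P (a * i + b * j + c * k)"
    if "maxrep i (Suc j) k" "n = a * i + b * Suc j + c * k" for i j k
  proof -
    have m: "maxrep i j k" using maxrep_mono[OF that(1)] by simp
    have "n = b + (a * i + b * j + c * k)" using that(2) by simp
    then show ?thesis
      unfolding coeff_prod_monom[OF gens_Ap(2)]
      using that(1) m compat_gens(2)[OF m] by (simp add: maxrep_def)
  qed
  show ?thesis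
  proof (cases y)
    case (Suc j)
    then show ?thesis using pred[of x j z] T in_T_iff by (simp add: n_def)
  next
    case 0
    show ?thesis
    proof (cases "p \<le> x \<and> r \<le> z")
      case True
      then obtain i k where ik: "x = i + p" "z = k + r" by (metis le_add_diff_inverse2)
      have "maxrep i (Suc (p + r - 1)) k"
        using maxrep_exchange[of i 1 0 k] T in_T_iff[of x y z] p_pos 0 ik by simp
      moreover have "n = a * i + b * Suc (p + r - 1) + c * k"
        using relation p_pos 0 ik unfolding n_def by (simp add: algebra_simps)
      ultimately have "coeff (apery_prod S G (monom 1 b) P) n = coeff P (a * i + b * (p + r - 1) + c * k)"
        by (rule pred)
      then show ?thesis using 0 True ik by (simp add: n_def)
    next
      case False
      have "\<not> (b \<le> n \<and> n - b \<in> Ap \<and> compat b (n - b))"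
      proof (intro notI, elim conjE)
        assume n: "b \<le> n" "n - b \<in> Ap" "compat b (n - b)"
        obtain i j k where u: "maxrep i j k" "n - b = a * i + b * j + c * k" "j < p + r"
          using maxrep_normal[OF n(2)] .
        have m: "maxrep i (Suc j) k" using compat_gens(2)[OF u(1)] n(3) u(2) by simp
        have n_eq: "a * x + b * y + c * z = a * i + b * Suc j + c * k"
          using n(1) u(2) by (simp add: n_def)
        show False
        proof (cases "Suc j < p + r")
          case True
          then show False using T_eqI(2)[OF T m _ n_eq] 0 by simp
        next
          case wrap: False
          then have j: "Suc j = p + r" using u(3) by simp
          \<comment> \<open>The exchanged exponent is normal, so uniqueness would force
            \<open>p \<le> x\<close> and \<open>r \<le> z\<close>.\<close>
          have "maxrep (i + p) 0 (k + r)" using maxrep_exchange[of i 1 0 k] m j by simp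
          moreover have "a * x + b * y + c * z = a * (i + p) + b * 0 + c * (k + r)"
            unfolding n_eq j using relation by (simp add: algebra_simps)
          ultimately show False using T_eqI[OF T] p_pos False by (metis add_gr_0 le_add2)
        qed
      qed
      then show ?thesis
        unfolding coeff_prod_monom[OF gens_Ap(2)] n_def[symmetric] using 0 False by auto
    qed
  qed
qed

definition linear_form :: "'k::field \<Rightarrow> 'k poly" where
  "linear_form e = monom 1 a + smult e (monom 1 b) + monom 1 c"

text \<open>For \<open>e \<noteq> 0\<close>, the coordinates in the basis \<open>e ^ shift y\<close>
  times \<open>t^weight\<close>.\<close>

fun coord :: "'k::field \<Rightarrow> 'k poly \<Rightarrow> nat \<times> nat \<times> nat \<Rightarrow> 'k" where
  "coord e P (x, y, z) =
     (if (x, y, z) \<in> T then coeff P (weight (x, y, z)) / e ^ shift y else 0)"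

text \<open>The factor \<open>e\<close> of the \<open>b\<close> term is absorbed where
  \<open>shift\<close> grows by one. It survives at \<open>y = Suc bs\<close>, where
  \<open>shift\<close> stays constant, and as a power in the wrapped term.\<close>

lemma coord_linear_form:
  assumes e: "e \<noteq> 0"
  shows "coord e (apery_prod S G (linear_form e) P) = ell e (coord e P)"
proof (rule HOL.ext)
  fix u :: "nat \<times> nat \<times> nat"
  obtain x y z where u: "u = (x, y, z)" by (cases u)
  show "coord e (apery_prod S G (linear_form e) P) u = ell e (coord e P) u"
  proof (cases "u \<in> T")
    case False
    then show ?thesis by (simp add: u)
  next
    case True
    then have T: "(x, y, z) \<in> T" "maxrep x y z" "y < p + r" using in_T_iff unfolding u by auto
    have down: "(x', y', z') \<in> T" if "x' \<le> x" "y' \<le> y" "z' \<le> z" for x' y' z'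
      using that maxrep_mono[OF T(2)] T(3) in_T_iff by simp
    have wrap: "(x - p, p + r - 1, z - r) \<in> T" if "y = 0" "p \<le> x" "r \<le> z"
    proof -
      have "maxrep (x - p) (p + r) (z - r)"
        using maxrep_exchange[of "x - p" 1 0 "z - r"] T(2) that by simp
      then have "maxrep (x - p) (p + r - 1) (z - r)" by (rule maxrep_mono) simp_all
      then show ?thesis unfolding in_T_iff using p_pos by simp
    qed
    have shift: "e / e ^ shift y = (if y = Suc bs then e else 1) / e ^ shift (y - 1)" if y: "y \<noteq> 0"
    proof -
      obtain j where j: "y = Suc j" using y not0_implies_Suc by blast
      show ?thesis
      proof (cases "j = bs")
        case False
        then have "shift y = Suc (shift j)" unfolding shift_def j by auto
        then show ?thesis using e False by (simp add: j)
      qed (simp add: shift_def j)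
    qed
    let ?n = "weight (x, y, z)"
    define A B D where "A = coeff (apery_prod S G (monom 1 a) P) ?n"
      and "B = coeff (apery_prod S G (monom 1 b) P) ?n"
      and "D = coeff (apery_prod S G (monom 1 c) P) ?n"
    have A: "A / e ^ shift y = (if x = 0 then 0 else coord e P (x - 1, y, z))"
      unfolding A_def coeff_prod_a[OF T(1)] using down[of "x - 1" y z] by simp
    have D: "D / e ^ shift y = (if z = 0 then 0 else coord e P (x, y, z - 1))"
      unfolding D_def coeff_prod_c[OF T(1)] using down[of x y "z - 1"] by simp
    have B: "e * B / e ^ shift y = (if y = 0 then
        if p \<le> x \<and> r \<le> z then
          e ^ Suc (shift (p + r - 1)) * coord e P (x - p, p + r - 1, z - r) else 0
      else (if y = Suc bs then e else 1) * coord e P (x, y - 1, z))"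
    proof (cases "y = 0")
      case True
      have 0: "shift 0 = 0" by (simp add: shift_def)
      show ?thesis
      proof (cases "p \<le> x \<and> r \<le> z")
        case wr: True
        have "coord e P (x - p, p + r - 1, z - r) = B / e ^ shift (p + r - 1)"
          using wrap[OF True] wr True unfolding B_def coeff_prod_b[OF T(1)] coord.simps by simp
        then show ?thesis using True wr 0 e by simp
      next
        case False
        have "B = 0" unfolding B_def coeff_prod_b[OF T(1)] if_P[OF True] if_not_P[OF False] ..
        then show ?thesis unfolding if_P[OF True] if_not_P[OF False] by simp
      qed
    next
      case False
      have "coord e P (x, y - 1, z) = B / e ^ shift (y - 1)"
        using down[of x "y - 1" z] False unfolding B_def coeff_prod_b[OF T(1)] coord.simps by simp
      moreover have "e * B / e ^ shift y = e / e ^ shift y * B" by simp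
      ultimately show ?thesis using False shift[OF False] by simp
    qed
    have "coord e (apery_prod S G (linear_form e) P) u = (A + e * B + D) / e ^ shift y"
      unfolding u coord.simps linear_form_def prod_add_l prod_scale_l coeff_add coeff_smult
        A_def B_def D_def using T(1) by simp
    also have "\<dots> = A / e ^ shift y + D / e ^ shift y + e * B / e ^ shift y"
      by (simp add: add_divide_distrib)
    also have "\<dots> = ell e (coord e P) u"
      unfolding A B D u ell.simps using T(1) by (simp only: if_True)
    finally show ?thesis .
  qed
qed

lemma coord_supported:
  assumes "P \<in> apery_component S G i" shows "coord e P \<in> supported deg T i"
  unfolding supported_def mem_Collect_eq
proof (intro allI impI)
  fix u assume nz: "coord e P u \<noteq> 0"
  obtain x y z where u: "u = (x, y, z)" by (cases u)
  have T: "u \<in> T" and "coeff P (weight u) \<noteq> 0" using nz unfolding u by (auto split: if_splits)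
  then have "od (weight u) = i" using component_coeff[OF assms] by blast
  then show "u \<in> T \<and> deg u = i" using T ord_weight by simp
qed

lemma coord_eq_0:
  assumes "P \<in> apery_component S G i" "e \<noteq> 0" "coord e P = (\<lambda>_. 0)"
  shows "P = 0"
proof (rule poly_eqI, rule ccontr)
  fix n assume n: "coeff P n \<noteq> coeff 0 n"
  then have "n \<in> weight ` T" using component_coeff[OF assms(1)] weight_T by simp
  then obtain x y z where u: "(x, y, z) \<in> T" "n = weight (x, y, z)" by auto
  then show False using fun_cong[OF assms(3), of "(x, y, z)"] assms(2) n by simp
qed

lemma coord_surj:
  assumes f: "f \<in> supported deg T i" and e: "e \<noteq> 0"
  obtains P where "P \<in> apery_component S G i" "coord e P = f"
proof -
  define P where "P = (\<Sum>u\<in>T. monom (f u * e ^ shift (fst (snd u))) (weight u))"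
  have coeff: "coeff P (weight v) = f v * e ^ shift (fst (snd v))" if v: "v \<in> T" for v
  proof -
    have "coeff P (weight v) = (\<Sum>u\<in>T. if u = v then f u * e ^ shift (fst (snd u)) else 0)"
      unfolding P_def coeff_sum coeff_monom
      by (intro sum.cong refl if_cong) (use v weight_inj in \<open>auto simp: inj_on_def\<close>)
    then show ?thesis using v finite_T by simp
  qed
  have "P \<in> apery_component S G i"
    unfolding apery_component_iff
  proof (intro allI impI)
    fix n assume n: "coeff P n \<noteq> 0"
    have "n \<in> weight ` T"
    proof (rule ccontr)
      assume "n \<notin> weight ` T"
      then have "coeff P n = 0" unfolding P_def coeff_sum coeff_monom by (intro sum.neutral) auto
      then show False using n by simp
    qed
    then obtain v where v: "v \<in> T" "n = weight v" by blast
    then have "f v \<noteq> 0" using n coeff by auto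
    then have "deg v = i" using f unfolding supported_def by blast
    then show "n \<in> Ap \<and> od n = i" using v ord_weight weight_T by blast
  qed
  moreover have "coord e P = f"
  proof (rule HOL.ext)
    fix u :: "nat \<times> nat \<times> nat"
    obtain x y z where u: "u = (x, y, z)" by (cases u)
    have "f u = 0" if "u \<notin> T" using f that unfolding supported_def by blast
    then show "coord e P u = f u" using coeff[of u] e unfolding u by simp
  qed
  ultimately show thesis using that by blast
qed

lemma strong_lefschetz:
  "standard_graded_artinian_algebra.strong_lefschetz
     (apery_prod S G) (1 :: 'k::field_char_0 poly) (apery_component S G)"
proof -
  interpret A: standard_graded_artinian_algebra "smult :: 'k \<Rightarrow> _" "apery_prod S G" 1
    "apery_component S G" by (rule apery_algebra)
  let ?A = "apery_component S G :: nat \<Rightarrow> 'k poly set"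
  obtain d :: "'k poly" where d: "d \<noteq> 0" and rank: "\<forall>e. poly d e \<noteq> 0 \<longrightarrow> (\<forall>i j.
      (\<forall>f\<in>supported deg T i. (ell e ^^ j) f = (\<lambda>_. 0) \<longrightarrow> f = (\<lambda>_. 0)) \<or>
      (\<forall>g\<in>supported deg T (i + j). \<exists>f\<in>supported deg T i. (ell e ^^ j) f = g))"
    using generic_maximal_rank[where 'k = 'k] by (elim exE conjE)
  \<comment> \<open>The extra factor excludes \<open>e = 0\<close>, where the rescaled coordinates
    break down; an infinite field has a point off the finitely many roots.\<close>
  have "finite {e. poly ([:0, 1:] * d) e = 0}" using d by (intro poly_roots_finite) simp
  then obtain e where "poly ([:0, 1:] * d) e \<noteq> 0"
    using ex_new_if_finite[OF infinite_UNIV_char_0] by blast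
  then have e: "e \<noteq> 0" "poly d e \<noteq> 0" by auto
  define l where "l = linear_form e"
  have l: "l \<in> ?A 1"
    unfolding l_def linear_form_def apery_component_iff using gens_Ap gens_ord by (auto split: if_splits)
  have carr: "?A i \<subseteq> A.span (\<Union>i. ?A i)" for i using A.span_superset by blast
  have pow: "A.algebra_power l j \<in> ?A j" for j
  proof (induction j)
    case 0
    show ?case using A.connected A.span_base by simp
  qed (use A.prod_component[OF l] in force)
  have mult_pow: "coord e (apery_prod S G (A.algebra_power l j) x) = (ell e ^^ j) (coord e x)"
    if x: "x \<in> ?A i" for i j x
  proof (induction j)
    case 0
    have "apery_prod S G 1 x = x" using x carr by (intro A.one_prod) blast
    then show ?case by simp
  next
    case (Suc j)
    have "apery_prod S G (A.algebra_power l (Suc j)) x =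
        apery_prod S G l (apery_prod S G (A.algebra_power l j) x)"
      unfolding A.algebra_power.simps using l pow[of j] x carr by (intro A.prod_assoc) blast+
    then show ?case using Suc coord_linear_form[OF e(1)] by (simp add: l_def)
  qed
  have prod_pow: "apery_prod S G (A.algebra_power l j) x \<in> ?A (i + j)" if "x \<in> ?A i" for i j x
    using A.prod_component[OF pow that, of j] by (simp add: add.commute)
  have "inj_on (apery_prod S G (A.algebra_power l j)) (?A i) \<or>
      apery_prod S G (A.algebra_power l j) ` ?A i = ?A (i + j)" for i j
    using rank[THEN spec, THEN mp, OF e(2), THEN spec, THEN spec, of i j]
  proof (elim disjE)
    assume inj: "\<forall>f\<in>supported deg T i. (ell e ^^ j) f = (\<lambda>_. 0) \<longrightarrow> f = (\<lambda>_. 0)"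
    have "x = y" if xy: "x \<in> ?A i" "y \<in> ?A i"
      "apery_prod S G (A.algebra_power l j) x = apery_prod S G (A.algebra_power l j) y" for x y
    proof -
      have diff: "x - y \<in> ?A i" using A.subspace_diff[OF A.subspace_component] xy by blast
      have "apery_prod S G (A.algebra_power l j) x =
          apery_prod S G (A.algebra_power l j) (x - y) + apery_prod S G (A.algebra_power l j) y"
        using prod_add_r[of "A.algebra_power l j" "x - y" y] by simp
      then have "apery_prod S G (A.algebra_power l j) (x - y) = 0" using xy(3) by simp
      moreover have "coord e (0 :: 'k poly) = (\<lambda>_. 0)" by (rule HOL.ext, rename_tac u, case_tac u) simp
      ultimately have "(ell e ^^ j) (coord e (x - y)) = (\<lambda>_. 0)"
        using mult_pow[OF diff, of j] by simp
      then have "coord e (x - y) = (\<lambda>_. 0)" using inj coord_supported[OF diff] by blast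
      then show "x = y" using coord_eq_0[OF diff e(1)] by simp
    qed
    then show ?thesis by (intro disjI1 inj_onI)
  next
    assume surj: "\<forall>g\<in>supported deg T (i + j). \<exists>f\<in>supported deg T i. (ell e ^^ j) f = g"
    have "y \<in> apery_prod S G (A.algebra_power l j) ` ?A i" if y: "y \<in> ?A (i + j)" for y
    proof -
      obtain f where f: "f \<in> supported deg T i" "(ell e ^^ j) f = coord e y"
        using surj coord_supported[OF y] by blast
      obtain x where x: "x \<in> ?A i" "coord e x = f" using coord_surj[OF f(1) e(1)] .
      let ?z = "apery_prod S G (A.algebra_power l j) x"
      have diff: "?z - y \<in> ?A (i + j)"
        using A.subspace_diff[OF A.subspace_component prod_pow[OF x(1)] y] .
      have "coord e ?z = coord e y" using mult_pow[OF x(1)] x(2) f(2) by simp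
      then have "coord e (?z - y) u = 0" for u
        by (cases u) (auto dest!: fun_cong[where x = u] simp: diff_divide_distrib)
      then have "?z - y = 0" using coord_eq_0[OF diff e(1)] by blast
      then show ?thesis using x(1) by auto
    qed
    then show ?thesis using prod_pow by blast
  qed
  then show ?thesis unfolding A.strong_lefschetz_def using l by blast
qed

end

section \<open>Ordering the generators and choosing the top exponent\<close>

theorem corollary2:
  fixes S G :: "nat set"
  assumes "numerical_semigroup S"
    and "minimally_generates G S"
    and "card G = 4"
    and "standard_graded_artinian_algebra.gorenstein
           (smult :: 'k::field_char_0 \<Rightarrow> 'k poly \<Rightarrow> 'k poly)
           (apery_prod S G) (apery_component S G)"
  shows "standard_graded_artinian_algebra.strong_lefschetz
           (apery_prod S G) (1 :: 'k poly) (apery_component S G)"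
proof -
  interpret minimally_generated_semigroup S G
    using assms(1,2) by unfold_locales
  define L where "L = sorted_list_of_set G"
  have L: "set L = G" "sorted_wrt (<) L" "length L = 4"
    unfolding L_def using finG assms(3) by simp_all
  then obtain m a b c where L_eq: "L = [m, a, b, c]"
    by (auto simp: numeral_eq_Suc length_Suc_conv)
  have G: "G = {m, a, b, c}" and less: "m < a" "a < b" "b < c"
    using L(1,2) unfolding L_eq by auto
  \<comment> \<open>Dividing both gaps by their gcd puts \<open>p : r\<close> in lowest
    terms.\<close>
  define g p r where "g = gcd (c - b) (b - a)" and "p = (c - b) div g" and "r = (b - a) div g"
  have g: "0 < g" unfolding g_def using less by simp
  have eq: "c - b = g * p" "b - a = g * r" unfolding p_def r_def g_def by simp_all
  have "coprime p r" unfolding p_def r_def g_def using less by (intro div_gcd_coprime) simp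
  then interpret four_generated S G m a b c g p r
    using G less g eq by unfold_locales (auto intro: gr0I)
  obtain w where w: "w \<in> Ap" "\<forall>v\<in>Ap. \<exists>v'\<in>Ap. compat v v' \<and> v + v' = w"
    using gorenstein_top[OF assms(4)] .
  \<comment> \<open>The top is taken in normal form, which gives \<open>bs < p + r\<close>.\<close>
  obtain as bs cs where top: "maxrep as bs cs" "w = a * as + b * bs + c * cs" "bs < p + r"
    using maxrep_normal[OF w(1)] .
  interpret gorenstein_four_generated S G m a b c g p r as bs cs
    using top w(2) by unfold_locales auto
  show ?thesis by (rule strong_lefschetz)
qed

end
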